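(* Let $N\ge 2$ be an integer, let $p>1$ and $\sigma>0$ be real numbers. Assume $w\in C_0^\alpha(\mathbb{R}^N)\cap L^1(\mathbb{R}^N)$ for some $\alpha\in(0,1)$ and $\int_{\mathbb{R}^N}w(x)\,dx>0$. Then for any $u_0\in C_0(\mathbb{R}^N)$, the solution of the integral equation $$u(t)=e^{t\Delta}u_0+\int_0^t e^{(t-s)\Delta}\left(|u(s)|^p+s^\sigma w\right)ds \qquad (\ast)$$ blows up in finite time.
   Context: All functions are real-valued (no sign condition is imposed on $u_0$ or $w$). $C_0(\mathbb{R}^N)$ is the space of continuous functions on $\mathbb{R}^N$ vanishing at infinity, equipped with the supremum norm. For $\alpha\in(0,1)$, $C_0^\alpha(\mathbb{R}^N)=C^\alpha(\mathbb{R}^N)\cap C_0(\mathbb{R}^N)$, where $C^\alpha(\mathbb{R}^N)$ is the space of Hölder continuous functions with exponent $\alpha$. $e^{t\Delta}$ denotes the heat semigroup on $\mathbb{R}^N$: $(e^{t\Delta}\varphi)(x)=(4\pi t)^{-N/2}\int_{\mathbb{R}^N}e^{-|x-y|^2/(4t)}\varphi(y)\,dy$ for $t>0$, and $e^{0\Delta}\varphi=\varphi$. A solution of $(\ast)$ on $[0,T]$ is a function $u\in C([0,T],C_0(\mathbb{R}^N))$ satisfying $(\ast)$ for all $0\le t\le T$; such solutions are unique. ($(\ast)$ is the integral form of $\partial_t u=\Delta u+|u|^p+t^\sigma w(x)$, $u(0,x)=u_0(x)$.) Put $T_{\max}=\sup\{t>0:\ (\ast)\text{ admits a solution in }C([0,t],C_0(\mathbb{R}^N))\}\in(0,\infty]$;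 the solution of $(\ast)$ means the unique maximal solution $u\in C([0,T_{\max}),C_0(\mathbb{R}^N))$. The solution blows up in finite time if $T_{\max}<\infty$ and $\lim_{t\to T_{\max}^-}\|u(t)\|_{L^\infty}=\infty$. *)

theory Defs
  imports "HOL-Analysis.Analysis" "HOL-Probability.Distributions"
begin

text \<open>\<open>C\<^sub>0\<close> is a subset of the Banach space of bounded continuous functions, whose norm and
  topology are those of the supremum norm.\<close>

definition C0 :: "((real ^ 'n) \<Rightarrow>\<^sub>C real) set" where
  "C0 = {f. (apply_bcontfun f \<longlongrightarrow> 0) at_infinity}"

definition holder_continuous :: "real \<Rightarrow> ((real ^ 'n) \<Rightarrow> real) \<Rightarrow> bool" where
  "holder_continuous \<alpha> f \<longleftrightarrow> (\<exists>C. \<forall>x y. \<bar>f x - f y\<bar> \<le> C * norm (x - y) powr \<alpha>)"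

definition C0_holder :: "real \<Rightarrow> ((real ^ 'n) \<Rightarrow>\<^sub>C real) set" where
  "C0_holder \<alpha> = {f \<in> C0. holder_continuous \<alpha> (apply_bcontfun f)}"

lemma integrable_gaussian:
  fixes t :: real
  assumes t: "t > 0"
  shows "integrable lborel (\<lambda>z :: real ^ 'n. exp (- (norm z)\<^sup>2 / (4 * t)))"
proof -
  define g where "g = (\<lambda>x :: real. exp (- x\<^sup>2 / (4 * t)))"
  have "integrable lborel (normal_density 0 (sqrt (2 * t)))"
    using t by (intro integrable_normal_density) auto
  then have "integrable lborel (\<lambda>x. sqrt (4 * pi * t) * normal_density 0 (sqrt (2 * t)) x)"
    by (rule integrable_mult_right)
  also have "(\<lambda>x. sqrt (4 * pi * t) * normal_density 0 (sqrt (2 * t)) x) = g"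
    using t by (auto simp: normal_density_def g_def fun_eq_iff field_simps)
  finally have g: "integrable lborel g" .
  have prod: "exp (- (norm z)\<^sup>2 / (4 * t)) = (\<Prod>b\<in>Basis. g (z \<bullet> b))" for z :: "real ^ 'n"
  proof -
    have "(norm z)\<^sup>2 = (\<Sum>b\<in>Basis. (z \<bullet> b)\<^sup>2)"
      unfolding power2_norm_eq_inner by (subst euclidean_inner) (simp add: power2_eq_square)
    then show ?thesis
      by (simp add: g_def exp_sum[symmetric] sum_negf sum_divide_distrib)
  qed
  have "(\<integral>\<^sup>+z. ennreal (norm (exp (- (norm (z :: real ^ 'n))\<^sup>2 / (4 * t)))) \<partial>lborel)
      = (\<integral>\<^sup>+z. (\<Prod>b\<in>(Basis :: (real ^ 'n) set). ennreal (g (z \<bullet> b))) \<partial>lborel)"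
    unfolding prod by (intro nn_integral_cong) (auto simp: g_def prod_ennreal abs_prod)
  also have "\<dots> = (\<Prod>b\<in>(Basis :: (real ^ 'n) set). \<integral>\<^sup>+x. ennreal (g x) \<partial>lborel)"
    by (rule nn_integral_lborel_prod) (auto simp: g_def)
  also have "\<dots> < \<infinity>"
    using g by (auto simp: integrable_iff_bounded g_def power_less_top_ennreal less_top)
  finally show ?thesis
    by (auto simp: integrable_iff_bounded)
qed

lemma heat_bcontfun:
  fixes f :: "(real ^ 'n) \<Rightarrow> real" and t :: real
  assumes f: "f \<in> bcontfun" and t: "t > 0"
  shows "(\<lambda>x. (4 * pi * t) powr (- real CARD('n) / 2) *
            (\<integral>y. exp (- (norm (x - y))\<^sup>2 / (4 * t)) * f y \<partial>lborel)) \<in> bcontfun"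
proof -
  define G where "G = (\<lambda>z :: real ^ 'n. exp (- (norm z)\<^sup>2 / (4 * t)))"
  have G: "integrable lborel G"
    unfolding G_def by (rule integrable_gaussian[OF t])
  have [measurable]: "G \<in> borel_measurable borel"
    unfolding G_def by measurable
  have cf: "continuous_on UNIV f" and "bounded (range f)"
    using f by (auto simp: bcontfun_def)
  then obtain B where B: "\<And>x. \<bar>f x\<bar> \<le> B"
    by (auto simp: bounded_iff)
  have [measurable]: "f \<in> borel_measurable borel"
    using cf by (rule borel_measurable_continuous_onI)
  have eq: "(\<integral>y. exp (- (norm (x - y))\<^sup>2 / (4 * t)) * f y \<partial>lborel) = (\<integral>z. G z * f (x + z) \<partial>lborel)"
    for x
    by (subst lborel_distr_plus[of x, symmetric], subst integral_distr) (auto simp: G_def)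
  have dom: "\<bar>G z * f y\<bar> \<le> B * G z" for z y
    using B[of y] by (auto simp: G_def abs_mult intro!: mult_right_mono)
  have GB: "integrable lborel (\<lambda>z. B * G z)"
    using G by (rule integrable_mult_right)
  have "continuous_on UNIV (\<lambda>x. \<integral>z. G z * f (x + z) \<partial>lborel)"
    unfolding continuous_on_eq_continuous_at[OF open_UNIV] continuous_at_sequentially comp_def
  proof (intro ballI allI impI)
    fix a :: "real ^ 'n" and x :: "nat \<Rightarrow> real ^ 'n"
    assume x: "x \<longlonglongrightarrow> a"
    show "(\<lambda>i. \<integral>z. G z * f (x i + z) \<partial>lborel) \<longlonglongrightarrow> (\<integral>z. G z * f (a + z) \<partial>lborel)"
    proof (rule integral_dominated_convergence[OF _ _ GB])
      have "(\<lambda>i. f (x i + z)) \<longlonglongrightarrow> f (a + z)" for z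
        by (rule continuous_on_tendsto_compose[OF cf]) (auto intro!: tendsto_intros x)
      then show "AE z in lborel. (\<lambda>i. G z * f (x i + z)) \<longlonglongrightarrow> G z * f (a + z)"
        by (intro AE_I2 tendsto_mult tendsto_const) auto
    qed (use dom in auto)
  qed
  moreover have "\<bar>\<integral>z. G z * f (x + z) \<partial>lborel\<bar> \<le> (\<integral>z. B * G z \<partial>lborel)" for x
  proof -
    have "norm (\<integral>z. G z * f (x + z) \<partial>lborel) \<le> (\<integral>z. B * G z \<partial>lborel)"
    proof (rule Bochner_Integration.integral_norm_bound_integral[OF _ GB])
      show "integrable lborel (\<lambda>z. G z * f (x + z))"
        by (rule Bochner_Integration.integrable_bound[OF GB])
          (auto intro!: AE_I2 order_trans[OF dom abs_ge_self])
    qed (use dom in auto)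
    then show ?thesis by simp
  qed
  then have "bounded (range (\<lambda>x. (4 * pi * t) powr (- real CARD('n) / 2) *
      (\<integral>z. G z * f (x + z) \<partial>lborel)))"
    unfolding bounded_iff
    by (intro exI[of _ "(4 * pi * t) powr (- real CARD('n) / 2) * (\<integral>z. B * G z \<partial>lborel)"])
      (simp add: abs_mult mult_left_mono)
  ultimately show ?thesis
    unfolding eq bcontfun_def by (auto intro!: continuous_intros)
qed

context
  includes bcontfun.lifting
begin

text \<open>The heat semigroup. The value for negative times, which is never used, is set to the
  identity so that the operator is total.\<close>

lift_definition heat :: "real \<Rightarrow> ((real ^ 'n) \<Rightarrow>\<^sub>C real) \<Rightarrow> ((real ^ 'n) \<Rightarrow>\<^sub>C real)" is
  "\<lambda>t f. if t > 0
     then (\<lambda>x. (4 * pi * t) powr (- real CARD('n) / 2) *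
            (\<integral>y. exp (- (norm (x - y))\<^sup>2 / (4 * t)) * f y \<partial>lborel))
     else f"
  using heat_bcontfun by auto

text \<open>The function \<open>|f|^p\<close>. The guard only ensures that the operation is total: for
  \<open>p \<le> 0\<close> the function need be neither bounded nor continuous.\<close>

lift_definition abs_powr :: "real \<Rightarrow> ((real ^ 'n) \<Rightarrow>\<^sub>C real) \<Rightarrow> ((real ^ 'n) \<Rightarrow>\<^sub>C real)" is
  "\<lambda>p f. if p > 0 then (\<lambda>x. \<bar>f x\<bar> powr p) else (\<lambda>x. 0)"
proof -
  fix p :: real and f :: "(real ^ 'n) \<Rightarrow> real"
  assume f: "f \<in> bcontfun"
  show "(if p > 0 then (\<lambda>x. \<bar>f x\<bar> powr p) else (\<lambda>x. 0)) \<in> bcontfun"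
  proof (cases "p > 0")
    case True
    obtain B where B: "\<And>x. \<bar>f x\<bar> \<le> B"
      using f by (auto simp: bcontfun_def bounded_iff)
    have "\<bar>\<bar>f x\<bar> powr p\<bar> \<le> B powr p" for x
      using True B[of x] by (auto intro!: powr_mono2)
    then have "bounded (range (\<lambda>x. \<bar>f x\<bar> powr p))"
      by (auto simp: bounded_iff)
    moreover have "continuous_on UNIV (\<lambda>x. \<bar>f x\<bar> powr p)"
      using f True by (intro continuous_on_powr') (auto simp: bcontfun_def intro!: continuous_intros)
    ultimately show ?thesis
      using True by (auto simp: bcontfun_def)
  qed (auto simp: const_bcontfun)
qed

end

text \<open>A solution on \<open>[0,T]\<close>. The integral is that of a function on \<open>[0,t]\<close> with values in the
  Banach space of bounded continuous functions. Under the first two conditions, and if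
  \<open>w \<in> C0\<close>, \<open>p > 0\<close> and \<open>\<sigma> > 0\<close>, its integrand is continuous on \<open>[0,t]\<close>.\<close>

definition solution_on ::
  "real \<Rightarrow> real \<Rightarrow> ((real ^ 'n) \<Rightarrow>\<^sub>C real) \<Rightarrow> ((real ^ 'n) \<Rightarrow>\<^sub>C real) \<Rightarrow> real
     \<Rightarrow> (real \<Rightarrow> ((real ^ 'n) \<Rightarrow>\<^sub>C real)) \<Rightarrow> bool" where
  "solution_on p \<sigma> w u0 T u \<longleftrightarrow>
     (\<forall>t\<in>{0..T}. u t \<in> C0) \<and>
     continuous_on {0..T} u \<and>
     (\<forall>t\<in>{0..T}. u t = heat t u0
        + integral {0..t} (\<lambda>s. heat (t - s) (abs_powr p (u s) + (s powr \<sigma>) *\<^sub>R w)))"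

definition T_max ::
  "real \<Rightarrow> real \<Rightarrow> ((real ^ 'n) \<Rightarrow>\<^sub>C real) \<Rightarrow> ((real ^ 'n) \<Rightarrow>\<^sub>C real) \<Rightarrow> ereal" where
  "T_max p \<sigma> w u0 = Sup (ereal ` {t. t > 0 \<and> (\<exists>u. solution_on p \<sigma> w u0 t u)})"

text \<open>Values of \<open>u\<close> outside \<open>[0,T_max)\<close> are irrelevant.\<close>

definition maximal_solution ::
  "real \<Rightarrow> real \<Rightarrow> ((real ^ 'n) \<Rightarrow>\<^sub>C real) \<Rightarrow> ((real ^ 'n) \<Rightarrow>\<^sub>C real)
     \<Rightarrow> (real \<Rightarrow> ((real ^ 'n) \<Rightarrow>\<^sub>C real)) \<Rightarrow> bool" where
  "maximal_solution p \<sigma> w u0 u \<longleftrightarrow>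
     0 < T_max p \<sigma> w u0 \<and>
     (\<forall>T. 0 < T \<and> ereal T < T_max p \<sigma> w u0 \<longrightarrow> solution_on p \<sigma> w u0 T u)"

definition blows_up_in_finite_time ::
  "real \<Rightarrow> real \<Rightarrow> ((real ^ 'n) \<Rightarrow>\<^sub>C real) \<Rightarrow> ((real ^ 'n) \<Rightarrow>\<^sub>C real)
     \<Rightarrow> (real \<Rightarrow> ((real ^ 'n) \<Rightarrow>\<^sub>C real)) \<Rightarrow> bool" where
  "blows_up_in_finite_time p \<sigma> w u0 u \<longleftrightarrow>
     T_max p \<sigma> w u0 < \<infinity> \<and>
     filterlim (\<lambda>t. norm (u t)) at_top (at_left (real_of_ereal (T_max p \<sigma> w u0)))"

end

theory Submission
  imports Defs
begin

text \<open>Suppose that solutions existed on \<open>[0,T]\<close> for arbitrarily large \<open>T\<close>. The source \<open>t^\<sigma> w\<close> has positive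
mass and grows without bound, and on the last unit of time this alone forces blow-up. To see it,
fix \<open>\<tau>\<close> and test the solution against the backward heat kernel centred at the origin: let
\<open>v(t)\<close> be the value of \<open>heat (T + \<tau> - t) (u t)\<close> at \<open>0\<close>. By the semigroup law the contribution of
\<open>u0\<close> to \<open>v\<close> is constant in time, and Jensen's inequality for the probability measure given by the heat
kernel turns Duhamel's formula into the scalar inequality

\<open>v(t) \<ge> - \<parallel>u0\<parallel> + \<integral>\<^sub>0\<^sup>t |v(s)|^p ds + \<integral>\<^sub>0\<^sup>t s^\<sigma> (heat (T + \<tau> - s) w)(0) ds\<close>.

Since \<open>(4\<pi>r)^(N/2) (heat r w)(0)\<close> tends to the integral of \<open>w\<close> as \<open>r \<rightarrow> \<infinity>\<close>, the number \<open>(heat r w)(0)\<close>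
is nonnegative for all \<open>r \<ge> \<tau>\<close> and bounded below by some \<open>c > 0\<close> for \<open>\<tau> \<le> r \<le> \<tau> + 1\<close>, once \<open>\<tau>\<close> is
large. This \<open>\<tau>\<close> does not depend on \<open>T\<close>. Hence, for \<open>T - 1 \<le> t \<le> T\<close>,

\<open>v(t) \<ge> - \<parallel>u0\<parallel> + c (T - 1)^\<sigma> (t - (T - 1)) + \<integral> |v(s)|^p ds\<close>,

with the integral over \<open>[T - 1, t]\<close>. The slope \<open>c (T - 1)^\<sigma>\<close> is as large as desired because \<open>\<sigma> > 0\<close>,
and a function satisfying such an inequality with large slope becomes infinite within unit time, because
\<open>p > 1\<close>. This contradiction
(\<open>no_global_solution\<close>, from \<open>heat_abs_powr_ge\<close>, \<open>heat_eventually_positive\<close> and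
\<open>superlinear_integral_inequality_blowup\<close>) shows that the maximal existence time is finite.\<close>

text \<open>What remains is the Cauchy theory. The heat semigroup is a strongly continuous contraction
semigroup on \<open>C\<^sub>0\<close>, and \<open>f \<mapsto> |f|^p\<close> is Lipschitz continuous on bounded sets, so Banach's fixed point
theorem gives local solutions, on an interval whose length is controlled by a bound on the initial
value (\<open>local_existence\<close>). Gronwall's inequality gives uniqueness, which lets solutions on different
intervals be glued into the maximal one. If the norm stayed below some bound at times arbitrarily
close to the maximal time, restarting from such a time would carry the solution beyond it
(\<open>solution_extend\<close>); hence the norm tends to infinity.\<close>

section \<open>The heat kernel\<close>

definition heat_kernel :: "real \<Rightarrow> real ^ 'n \<Rightarrow> real" where
  "heat_kernel t z = (4 * pi * t) powr (- real CARD('n) / 2) * exp (- (norm z)\<^sup>2 / (4 * t))"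

lemma heat_kernel_nonneg [simp]: "0 \<le> heat_kernel t z"
  by (simp add: heat_kernel_def)

lemma measurable_heat_kernel [measurable]: "heat_kernel t \<in> borel_measurable borel"
  unfolding heat_kernel_def[abs_def] by measurable

lemma measurable_apply_bcontfun [measurable]:
  "apply_bcontfun (f :: (real ^ 'n) \<Rightarrow>\<^sub>C real) \<in> borel_measurable borel"
  by (rule borel_measurable_continuous_onI) simp

lemma heat_apply:
  assumes "t > 0"
  shows "apply_bcontfun (heat t f) x = (\<integral>y. heat_kernel t (x - y) * apply_bcontfun f y \<partial>lborel)"
  using assms by (simp add: heat.rep_eq heat_kernel_def mult.assoc)

lemma heat_0 [simp]: "heat 0 f = f"
  by (rule bcontfun_eqI) (simp add: heat.rep_eq)

lemma sqrt_power_eq_powr: "a > 0 \<Longrightarrow> sqrt a ^ n = a powr (real n / 2)"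
  by (simp add: powr_half_sqrt[symmetric] powr_power)

text \<open>The kernel is the density of independent centred normal variables of variance \<open>2 t\<close>, one for each
coordinate; its mass and its convolutions therefore reduce to the one-dimensional ones.\<close>

lemma heat_kernel_eq_prod:
  fixes z :: "real ^ 'n"
  assumes t: "t > 0"
  shows "heat_kernel t z = (\<Prod>b\<in>Basis. normal_density 0 (sqrt (2 * t)) (z \<bullet> b))"
proof -
  have "(norm z)\<^sup>2 = (\<Sum>b\<in>Basis. (z \<bullet> b)\<^sup>2)"
    unfolding power2_norm_eq_inner by (subst euclidean_inner) (simp add: power2_eq_square)
  then have "exp (- (norm z)\<^sup>2 / (4 * t)) = (\<Prod>b\<in>Basis. exp (- (z \<bullet> b)\<^sup>2 / (4 * t)))"
    by (simp add: sum_divide_distrib exp_sum flip: sum_negf)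
  moreover have "(4 * pi * t) powr (- real CARD('n) / 2)
      = (\<Prod>b\<in>(Basis :: (real ^ 'n) set). 1 / sqrt (4 * pi * t))"
    using t by (simp add: sqrt_power_eq_powr powr_minus_divide power_one_over)
  moreover have "normal_density 0 (sqrt (2 * t)) x = (1 / sqrt (4 * pi * t)) * exp (- x\<^sup>2 / (4 * t))"
    for x
    using t by (simp add: normal_density_def mult.commute mult.left_commute)
  ultimately show ?thesis
    unfolding heat_kernel_def by (simp only: prod.distrib)
qed

lemma nn_integral_heat_kernel:
  assumes t: "t > 0"
  shows "(\<integral>\<^sup>+z. ennreal (heat_kernel t (z :: real ^ 'n)) \<partial>lborel) = 1"
proof -
  have "(\<integral>\<^sup>+z. ennreal (heat_kernel t (z :: real ^ 'n)) \<partial>lborel)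
      = (\<integral>\<^sup>+z. (\<Prod>b\<in>(Basis :: (real ^ 'n) set).
            ennreal (normal_density 0 (sqrt (2 * t)) (z \<bullet> b))) \<partial>lborel)"
    using t by (intro nn_integral_cong) (simp add: heat_kernel_eq_prod prod_ennreal)
  also have "\<dots> = (\<Prod>b\<in>(Basis :: (real ^ 'n) set).
      \<integral>\<^sup>+x. ennreal (normal_density 0 (sqrt (2 * t)) x) \<partial>lborel)"
    by (rule nn_integral_lborel_prod) auto
  also have "\<dots> = 1"
    using t by (simp add: nn_integral_eq_integral)
  finally show ?thesis .
qed

lemma integrable_heat_kernel:
  "t > 0 \<Longrightarrow> integrable lborel (heat_kernel t :: real ^ 'n \<Rightarrow> real)"
  by (rule integrableI_nonneg) (auto simp: nn_integral_heat_kernel)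

lemma integral_heat_kernel:
  "t > 0 \<Longrightarrow> (\<integral>z. heat_kernel t (z :: real ^ 'n) \<partial>lborel) = 1"
  by (rule integral_eq_nn_integral[THEN trans]) (auto simp: nn_integral_heat_kernel)

text \<open>Independent centred normal variables add up to a normal variable, and their variances add.\<close>

lemma heat_kernel_convolution:
  fixes z :: "real ^ 'n"
  assumes s: "s > 0" and t: "t > 0"
  shows "(\<integral>y. heat_kernel s (z - y) * heat_kernel t y \<partial>lborel) = heat_kernel (s + t) z"
proof -
  let ?k = "\<lambda>t. normal_density 0 (sqrt (2 * t))"
  have "(\<integral>\<^sup>+y. ennreal (heat_kernel s (z - y) * heat_kernel t y) \<partial>lborel)
      = (\<integral>\<^sup>+y. (\<Prod>b\<in>(Basis :: (real ^ 'n) set).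
            ennreal (?k s (z \<bullet> b - y \<bullet> b) * ?k t (y \<bullet> b))) \<partial>lborel)"
    using s t by (intro nn_integral_cong)
      (simp add: heat_kernel_eq_prod prod_ennreal prod.distrib[symmetric] inner_diff_left)
  also have "\<dots> = (\<Prod>b\<in>(Basis :: (real ^ 'n) set).
      \<integral>\<^sup>+x. ennreal (?k s (z \<bullet> b - x) * ?k t x) \<partial>lborel)"
    by (rule nn_integral_lborel_prod[where f = "\<lambda>b x. ennreal (?k s (z \<bullet> b - x) * ?k t x)"]) auto
  also have "\<dots> = (\<Prod>b\<in>(Basis :: (real ^ 'n) set). ennreal (?k (s + t) (z \<bullet> b)))"
  proof (rule prod.cong)
    fix b :: "real ^ 'n"
    show "(\<integral>\<^sup>+x. ennreal (?k s (z \<bullet> b - x) * ?k t x) \<partial>lborel) = ennreal (?k (s + t) (z \<bullet> b))"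
      using fun_cong[OF conv_normal_density_zero_mean[of "sqrt (2 * s)" "sqrt (2 * t)"], of "z \<bullet> b"]
        s t by (simp add: distrib_left)
  qed simp
  also have "\<dots> = ennreal (heat_kernel (s + t) z)"
    using s t by (simp add: heat_kernel_eq_prod prod_ennreal)
  finally have *: "(\<integral>\<^sup>+y. ennreal (heat_kernel s (z - y) * heat_kernel t y) \<partial>lborel)
      = ennreal (heat_kernel (s + t) z)" .
  show ?thesis
    by (rule integral_eq_nn_integral[THEN trans]) (auto simp: *)
qed

section \<open>The heat semigroup on \<open>C\<^sub>0\<close>\<close>

lemma lborel_nn_integral_affine:
  fixes f :: "'a::euclidean_space \<Rightarrow> ennreal"
  assumes [measurable]: "f \<in> borel_measurable borel" and c: "c \<noteq> 0"
  shows "(\<integral>\<^sup>+y. f y \<partial>lborel)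
    = ennreal (\<bar>c\<bar> ^ DIM('a)) * (\<integral>\<^sup>+z. f (x + c *\<^sub>R z) \<partial>lborel)"
  by (subst lborel_affine[OF c, of x]) (simp add: nn_integral_density nn_integral_distr nn_integral_cmult)

lemma lborel_integral_affine:
  fixes f :: "'a::euclidean_space \<Rightarrow> real"
  assumes [measurable]: "f \<in> borel_measurable borel" and c: "c \<noteq> 0"
  shows "(\<integral>y. f y \<partial>lborel) = \<bar>c\<bar> ^ DIM('a) * (\<integral>z. f (x + c *\<^sub>R z) \<partial>lborel)"
  by (subst lborel_affine[OF c, of x]) (simp add: integral_density integral_distr)

text \<open>After the substitution \<open>y = x + 2 \<surd>t z\<close> the measure is a fixed probability measure and time sits
only in the argument of \<open>f\<close>. The formula includes \<open>t = 0\<close>, so that all later estimates hold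
up to the initial time.\<close>

lemma heat_scaled:
  fixes f :: "(real ^ 'n) \<Rightarrow>\<^sub>C real"
  assumes t: "t \<ge> 0"
  shows "apply_bcontfun (heat t f) x
    = (\<integral>z. heat_kernel (1/4) z * apply_bcontfun f (x + (2 * sqrt t) *\<^sub>R z) \<partial>lborel)"
proof (cases "t = 0")
  case True
  then show ?thesis
    using integral_heat_kernel[of "1/4", where 'n='n] by simp
next
  case False
  with t have t: "t > 0" by simp
  have scale: "(2 * sqrt t) ^ CARD('n) * heat_kernel t (x - (x + (2 * sqrt t) *\<^sub>R z))
      = heat_kernel (1/4) z" for z
  proof -
    have "(2 * sqrt t) ^ CARD('n) = (4 * t) powr (real CARD('n) / 2)"
      using t sqrt_power_eq_powr[of "4 * t" "CARD('n)"] by (simp add: real_sqrt_mult)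
    moreover have "(4 * pi * t) powr (- real CARD('n) / 2)
        = pi powr (- real CARD('n) / 2) * (4 * t) powr (- real CARD('n) / 2)"
      using t powr_mult[of pi "4 * t"] by (simp add: mult.commute mult.left_commute)
    moreover have "(norm ((2 * sqrt t) *\<^sub>R z))\<^sup>2 / (4 * t) = (norm z)\<^sup>2"
      using t by (simp add: power_mult_distrib)
    ultimately show ?thesis
      using t by (simp add: heat_kernel_def powr_minus)
  qed
  have "(\<integral>y. heat_kernel t (x - y) * apply_bcontfun f y \<partial>lborel)
     = (2 * sqrt t) ^ CARD('n) * (\<integral>z. heat_kernel t (x - (x + (2 * sqrt t) *\<^sub>R z))
          * apply_bcontfun f (x + (2 * sqrt t) *\<^sub>R z) \<partial>lborel)"
    using t by (subst lborel_integral_affine[where c = "2 * sqrt t" and x = x]) auto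
  also have "\<dots> = (\<integral>z. heat_kernel (1/4) z * apply_bcontfun f (x + (2 * sqrt t) *\<^sub>R z) \<partial>lborel)"
    unfolding scale[symmetric] by (simp add: mult.assoc)
  finally show ?thesis
    using t by (simp add: heat_apply)
qed

lemma integrable_heat_scaled:
  fixes f :: "(real ^ 'n) \<Rightarrow>\<^sub>C real"
  shows "integrable lborel (\<lambda>z. heat_kernel (1/4) z * apply_bcontfun f (x + c *\<^sub>R z))"
proof (rule Bochner_Integration.integrable_bound)
  show "integrable lborel (\<lambda>z :: real ^ 'n. norm f * heat_kernel (1/4) z)"
    by (intro integrable_mult_right integrable_heat_kernel) auto
  show "AE z in lborel. norm (heat_kernel (1/4) z * apply_bcontfun f (x + c *\<^sub>R z))
      \<le> norm (norm f * heat_kernel (1/4) z)"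
    using norm_bounded[of f] by (auto simp: abs_mult mult.commute intro!: mult_right_mono)
qed measurable

lemma heat_add:
  assumes "t \<ge> 0"
  shows "heat t (f + g) = heat t f + heat t g"
  using assms by (intro bcontfun_eqI)
    (simp add: heat_scaled distrib_left integrable_heat_scaled)

lemma heat_scaleR:
  assumes "t \<ge> 0"
  shows "heat t (c *\<^sub>R f) = c *\<^sub>R heat t f"
  using assms by (intro bcontfun_eqI) (simp add: heat_scaled mult.left_commute)

lemma heat_mono:
  assumes "t \<ge> 0" and "\<And>y. apply_bcontfun f y \<le> apply_bcontfun g y"
  shows "apply_bcontfun (heat t f) x \<le> apply_bcontfun (heat t g) x"
  using assms by (auto simp: heat_scaled intro!: integral_mono integrable_heat_scaled mult_left_mono)

lemma heat_const:
  assumes "t \<ge> 0"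
  shows "heat t (const_bcontfun c :: (real ^ 'n) \<Rightarrow>\<^sub>C real) = const_bcontfun c"
  using assms by (intro bcontfun_eqI) (simp add: heat_scaled integral_heat_kernel)

lemma norm_heat_le:
  assumes t: "t \<ge> 0"
  shows "norm (heat t f) \<le> norm f"
proof (rule norm_bound)
  fix x
  have "apply_bcontfun (heat t f) x \<le> apply_bcontfun (heat t (const_bcontfun (norm f))) x"
    using norm_bounded[of f] by (intro heat_mono t) (auto simp: abs_le_iff)
  moreover have "apply_bcontfun (heat t (const_bcontfun (- norm f))) x \<le> apply_bcontfun (heat t f) x"
    using norm_bounded[of f] by (intro heat_mono t) (auto simp: abs_le_iff minus_le_iff)
  ultimately show "norm (apply_bcontfun (heat t f) x) \<le> norm f"
    using t by (simp add: heat_const)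
qed

lemma bounded_linear_heat: "t \<ge> 0 \<Longrightarrow> bounded_linear (heat t)"
  by (rule bounded_linear_intro[where K = 1]) (auto simp: heat_add heat_scaleR norm_heat_le)

lemma heat_diff: "t \<ge> 0 \<Longrightarrow> heat t (f - g) = heat t f - heat t g"
  by (rule linear_diff[OF bounded_linear.linear[OF bounded_linear_heat]])

lemma heat_uminus: "t \<ge> 0 \<Longrightarrow> heat t (- f) = - heat t f"
  by (rule linear_neg[OF bounded_linear.linear[OF bounded_linear_heat]])

text \<open>Fubini's theorem reduces the semigroup law to the convolution identity for the kernels.\<close>

lemma heat_semigroup:
  fixes f :: "(real ^ 'n) \<Rightarrow>\<^sub>C real"
  assumes "s \<ge> 0" "t \<ge> 0"
  shows "heat s (heat t f) = heat (s + t) f"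
proof (cases "s = 0 \<or> t = 0")
  case False
  with assms have s: "s > 0" and t: "t > 0" by auto
  show ?thesis
  proof (rule bcontfun_eqI)
    fix x :: "real ^ 'n"
    let ?K = "\<lambda>y z. heat_kernel s (x - y) * heat_kernel t (y - z)"
    have shift: "integrable lborel (\<lambda>y. heat_kernel r (a - y))"
      "(\<integral>y. heat_kernel r (a - y) \<partial>lborel) = 1" if "r > 0" for r and a :: "real ^ 'n"
    proof -
      have "(\<integral>\<^sup>+y. ennreal (heat_kernel r (y :: real ^ 'n)) \<partial>lborel)
          = ennreal (\<bar>-1\<bar> ^ DIM(real ^ 'n))
            * (\<integral>\<^sup>+y. ennreal (heat_kernel r (a + (-1) *\<^sub>R y)) \<partial>lborel)"
        by (rule lborel_nn_integral_affine) auto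
      then have "(\<integral>\<^sup>+y. ennreal (heat_kernel r (a - y)) \<partial>lborel) = 1"
        using that by (simp add: nn_integral_heat_kernel)
      then show "integrable lborel (\<lambda>y. heat_kernel r (a - y))"
        "(\<integral>y. heat_kernel r (a - y) \<partial>lborel) = 1"
        by (auto intro!: integrableI_nonneg simp: integral_eq_nn_integral)
    qed
    have "integrable (lborel \<Otimes>\<^sub>M lborel) (\<lambda>(y, z). ?K y z)"
      by (rule lborel_pair.Fubini_integrable) (use s t in \<open>auto simp: abs_mult shift\<close>)
    then have "integrable (lborel \<Otimes>\<^sub>M lborel) (\<lambda>p. norm f * (case p of (y, z) \<Rightarrow> ?K y z))"
      by (rule integrable_mult_right)
    then have int: "integrable (lborel \<Otimes>\<^sub>M lborel) (\<lambda>(y, z). ?K y z * apply_bcontfun f z)"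
      by (rule Bochner_Integration.integrable_bound)
        (use norm_bounded[of f] in \<open>auto simp: abs_mult split_beta mult.commute[of "norm f"]
            intro!: mult_left_mono AE_I2\<close>)
    have "apply_bcontfun (heat s (heat t f)) x
        = (\<integral>y. (\<integral>z. ?K y z * apply_bcontfun f z \<partial>lborel) \<partial>lborel)"
      using s t by (simp add: heat_apply mult.assoc)
    also have "\<dots> = (\<integral>z. (\<integral>y. ?K y z * apply_bcontfun f z \<partial>lborel) \<partial>lborel)"
      using lborel_pair.Fubini_integral[OF int] by simp
    also have "\<dots> = (\<integral>z. heat_kernel (s + t) (x - z) * apply_bcontfun f z \<partial>lborel)"
    proof (rule Bochner_Integration.integral_cong)
      fix z
      have "(\<integral>y. ?K y z \<partial>lborel) = (\<integral>y. heat_kernel s ((x - z) - y) * heat_kernel t y \<partial>lborel)"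
        by (subst lborel_integral_affine[where c = 1 and x = z]) (auto simp: algebra_simps)
      then show "(\<integral>y. ?K y z * apply_bcontfun f z \<partial>lborel)
          = heat_kernel (s + t) (x - z) * apply_bcontfun f z"
        using s t by (simp add: heat_kernel_convolution)
    qed simp
    also have "\<dots> = apply_bcontfun (heat (s + t) f) x"
      using s t by (simp add: heat_apply)
    finally show "apply_bcontfun (heat s (heat t f)) x = apply_bcontfun (heat (s + t) f) x" .
  qed
qed auto

text \<open>The first moment of the kernel is finite. It is the one quantity that controls both the decay at
infinity and the modulus of continuity in time below.\<close>

lemma integrable_heat_kernel_norm:
  "integrable lborel (\<lambda>z :: real ^ 'n. heat_kernel (1/4) z * norm z)"
proof (rule Bochner_Integration.integrable_bound)
  let ?c = "pi powr (- real CARD('n) / 2)"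
  show "integrable lborel (\<lambda>z :: real ^ 'n. ?c * exp (- (norm z)\<^sup>2 / (4 * (1/2))))"
    by (intro integrable_mult_right integrable_gaussian) auto
  have "r * exp (- r\<^sup>2) \<le> exp (- r\<^sup>2 / 2)" for r :: real
  proof -
    have "r \<le> 1 + r\<^sup>2 / 2"
      using zero_le_power2[of "r - 1"] by (simp add: power2_diff)
    also have "\<dots> \<le> exp (r\<^sup>2 / 2)"
      by (rule exp_ge_add_one_self)
    finally have "r * exp (- r\<^sup>2) \<le> exp (r\<^sup>2 / 2) * exp (- r\<^sup>2)"
      by (intro mult_right_mono) auto
    then show ?thesis
      by (simp flip: exp_add)
  qed
  then show "AE z :: real ^ 'n in lborel. norm (heat_kernel (1/4) z * norm z)
      \<le> norm (?c * exp (- (norm z)\<^sup>2 / (4 * (1/2))))"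
    by (auto simp: heat_kernel_def abs_mult mult.assoc mult.commute[of "exp _" "norm _"]
        intro!: mult_left_mono)
qed measurable

text \<open>The decay of \<open>heat t f\<close> and its continuity in \<open>t\<close> both follow by bounding a function of \<open>z\<close>
by a small constant plus a multiple of \<open>|z|\<close>; the kernel is a probability density, so the constant
stays small after integration.\<close>

lemma heat_kernel_integral_linear_bound:
  assumes [measurable]: "h \<in> borel_measurable borel"
    and h: "\<And>z :: real ^ 'n. \<bar>h z\<bar> \<le> a + b * norm z"
  shows "\<bar>\<integral>z. heat_kernel (1/4) z * h z \<partial>lborel\<bar>
    \<le> a + b * (\<integral>z. heat_kernel (1/4) (z :: real ^ 'n) * norm z \<partial>lborel)"
proof -
  have int: "integrable lborel (\<lambda>z :: real ^ 'n. a * heat_kernel (1/4) z + b * (heat_kernel (1/4) z * norm z))"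
    by (intro Bochner_Integration.integrable_add integrable_mult_right integrable_heat_kernel
        integrable_heat_kernel_norm) auto
  have bound: "\<bar>heat_kernel (1/4) z * h z\<bar>
      \<le> a * heat_kernel (1/4) z + b * (heat_kernel (1/4) z * norm z)" for z
    using mult_left_mono[OF h[of z] heat_kernel_nonneg[of "1/4" z]]
    by (simp add: abs_mult algebra_simps)
  have "norm (\<integral>z. heat_kernel (1/4) z * h z \<partial>lborel)
      \<le> (\<integral>z. a * heat_kernel (1/4) (z :: real ^ 'n) + b * (heat_kernel (1/4) z * norm z) \<partial>lborel)"
  proof (rule Bochner_Integration.integral_norm_bound_integral[OF _ int])
    show "integrable lborel (\<lambda>z. heat_kernel (1/4) z * h z)"
      by (rule Bochner_Integration.integrable_bound[OF int])
        (auto intro!: AE_I2 order_trans[OF bound abs_ge_self])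
  qed (use bound in auto)
  then show ?thesis
    using integrable_heat_kernel_norm[where 'n='n] integrable_heat_kernel[of "1/4", where 'n='n]
    by (simp add: integral_heat_kernel)
qed

lemma C0_eventually:
  assumes "f \<in> C0" "e > 0"
  obtains R where "R > 0" "\<And>x. norm x \<ge> R \<Longrightarrow> \<bar>apply_bcontfun f x\<bar> < e"
proof -
  obtain R where R: "\<And>x. norm x \<ge> R \<Longrightarrow> \<bar>apply_bcontfun f x\<bar> < e"
    using assms tendstoD[of "apply_bcontfun f" 0 at_infinity e]
    by (auto simp: C0_def eventually_at_infinity)
  show ?thesis
    by (rule that[of "max R 1"]) (use R in auto)
qed

lemma C0I:
  assumes "\<And>e. e > 0 \<Longrightarrow> \<exists>R. \<forall>x. norm x \<ge> R \<longrightarrow> \<bar>apply_bcontfun f x\<bar> \<le> e"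
  shows "f \<in> C0"
  unfolding C0_def mem_Collect_eq
proof (rule tendstoI)
  fix e :: real
  assume "e > 0"
  then obtain R where "\<forall>x. norm x \<ge> R \<longrightarrow> \<bar>apply_bcontfun f x\<bar> \<le> e / 2"
    using assms[of "e / 2"] by auto
  then have "\<forall>x. norm x \<ge> R \<longrightarrow> \<bar>apply_bcontfun f x\<bar> < e"
    using \<open>e > 0\<close> by force
  then show "\<forall>\<^sub>F x in at_infinity. dist (apply_bcontfun f x) 0 < e"
    by (auto simp: eventually_at_infinity)
qed

text \<open>For \<open>|x|\<close> large, \<open>|f (x + 2 \<surd>t z)|\<close> is small unless \<open>|z|\<close> exceeds a large threshold \<open>M\<close>, and there
it is at most \<open>|z| \<parallel>f\<parallel> / M\<close>.\<close>

lemma heat_in_C0: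
  fixes f :: "(real ^ 'n) \<Rightarrow>\<^sub>C real"
  assumes f: "f \<in> C0" and t: "t \<ge> 0"
  shows "heat t f \<in> C0"
proof (rule C0I)
  fix e :: real
  assume e: "e > 0"
  define m where "m = (\<integral>z. heat_kernel (1/4) (z :: real ^ 'n) * norm z \<partial>lborel)"
  have m: "m \<ge> 0"
    unfolding m_def by (intro integral_nonneg_AE) auto
  obtain R where R: "R > 0" "\<And>x. norm x \<ge> R \<Longrightarrow> \<bar>apply_bcontfun f x\<bar> < e / 2"
    using C0_eventually[OF f, of "e / 2"] e by auto
  \<comment> \<open>The slope \<open>b\<close> is chosen so that the first moment contributes at most \<open>e / 2\<close>.\<close>
  define b where "b = e / (2 * (m + 1))"
  have b: "b > 0" "b * m \<le> e / 2"
    using e m by (auto simp: b_def field_simps)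
  define M where "M = norm f / b"
  have "\<bar>apply_bcontfun (heat t f) x\<bar> \<le> e" if x: "norm x \<ge> R + 2 * sqrt t * M" for x
  proof -
    have "\<bar>apply_bcontfun f (x + (2 * sqrt t) *\<^sub>R z)\<bar> \<le> e / 2 + b * norm z" for z
    proof (cases "norm z \<ge> M")
      case True
      have "\<bar>apply_bcontfun f (x + (2 * sqrt t) *\<^sub>R z)\<bar> \<le> norm f"
        using norm_bounded[of f] by simp
      also have "\<dots> = b * M"
        using b by (simp add: M_def)
      also have "\<dots> \<le> b * norm z"
        using True b by simp
      finally show ?thesis using e by simp
    next
      case False
      have "norm ((2 * sqrt t) *\<^sub>R z) \<le> 2 * sqrt t * M"
        using False t by (simp add: mult_left_mono)
      then have "norm (x + (2 * sqrt t) *\<^sub>R z) \<ge> R"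
        using x norm_diff_ineq[of x "(2 * sqrt t) *\<^sub>R z"] by linarith
      from R(2)[OF this] show ?thesis
        using b by (smt (verit) mult_nonneg_nonneg norm_ge_zero)
    qed
    then have "\<bar>apply_bcontfun (heat t f) x\<bar> \<le> e / 2 + b * m"
      unfolding heat_scaled[OF t] m_def by (intro heat_kernel_integral_linear_bound) auto
    then show ?thesis using b by linarith
  qed
  then show "\<exists>R. \<forall>x. norm x \<ge> R \<longrightarrow> \<bar>apply_bcontfun (heat t f) x\<bar> \<le> e"
    by blast
qed

lemma C0_uniformly_continuous:
  assumes f: "f \<in> C0" and e: "e > 0"
  obtains d where "d > 0"
    "\<And>x y. norm (x - y) < d \<Longrightarrow> \<bar>apply_bcontfun f x - apply_bcontfun f y\<bar> < e"
proof -
  obtain R where R: "R > 0" "\<And>x. norm x \<ge> R \<Longrightarrow> \<bar>apply_bcontfun f x\<bar> < e / 2"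
    using C0_eventually[OF f, of "e / 2"] e by auto
  have "uniformly_continuous_on (cball 0 (R + 1)) (apply_bcontfun f)"
    by (rule compact_uniformly_continuous) auto
  then obtain d where d: "d > 0" and close: "\<And>x y. \<lbrakk>y \<in> cball 0 (R + 1); x \<in> cball 0 (R + 1);
      dist x y < d\<rbrakk> \<Longrightarrow> dist (apply_bcontfun f x) (apply_bcontfun f y) < e"
    using e by (rule uniformly_continuous_onE) blast
  show ?thesis
  proof (rule that[of "min d 1"])
    fix x y :: "real ^ 'a"
    assume xy: "norm (x - y) < min d 1"
    show "\<bar>apply_bcontfun f x - apply_bcontfun f y\<bar> < e"
    proof (cases "norm x \<le> R + 1 \<and> norm y \<le> R + 1")
      case True
      then show ?thesis using close[of y x] xy by (simp add: dist_norm)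
    next
      case False
      then have "norm x \<ge> R" "norm y \<ge> R"
        using xy norm_triangle_ineq2[of x y] norm_triangle_ineq2[of y x]
        by (auto simp: norm_minus_commute)
      then show ?thesis using R(2)[of x] R(2)[of y] by linarith
    qed
  qed (use d in auto)
qed

text \<open>Strong continuity: by uniform continuity \<open>|f x - f y|\<close> is at most a small constant plus a multiple
of \<open>|x - y|\<close>, and in the scaled formula a change of time from \<open>s\<close> to \<open>t\<close> moves the argument by
\<open>2 |\<surd>t - \<surd>s| |z|\<close>.\<close>

lemma continuous_on_heat_time:
  fixes f :: "(real ^ 'n) \<Rightarrow>\<^sub>C real"
  assumes f: "f \<in> C0"
  shows "continuous_on {0..} (\<lambda>t. heat t f)"
  unfolding continuous_on_def
proof (intro ballI tendstoI)
  fix s e :: real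
  assume s: "s \<in> {0..}" and e: "e > 0"
  define m where "m = (\<integral>z. heat_kernel (1/4) (z :: real ^ 'n) * norm z \<partial>lborel)"
  obtain d where d: "d > 0"
    "\<And>x y. norm (x - y) < d \<Longrightarrow> \<bar>apply_bcontfun f x - apply_bcontfun f y\<bar> < e / 2"
    using C0_uniformly_continuous[OF f, of "e / 2"] e by auto
  have modulus: "\<bar>apply_bcontfun f x - apply_bcontfun f y\<bar> \<le> e / 2 + 2 * norm f / d * norm (x - y)"
    for x y
  proof (cases "norm (x - y) < d")
    case True
    have "0 \<le> 2 * norm f / d * norm (x - y)" using d by simp
    with d(2)[OF True] show ?thesis by linarith
  next
    case False
    have "\<bar>apply_bcontfun f x - apply_bcontfun f y\<bar> \<le> 2 * norm f"
      using norm_bounded[of f x] norm_bounded[of f y] by simp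
    also have "\<dots> \<le> 2 * norm f / d * norm (x - y)"
      using False d mult_left_mono[of d "norm (x - y)" "norm f"] by (simp add: field_simps)
    finally show ?thesis using e by simp
  qed
  define L where "L t = e / 2 + 2 * norm f / d * (2 * \<bar>sqrt t - sqrt s\<bar>) * m" for t
  have bound: "dist (heat t f) (heat s f) \<le> L t" if t: "t \<ge> 0" for t
  proof (rule dist_bound)
    fix x
    let ?h = "\<lambda>z. apply_bcontfun f (x + (2 * sqrt t) *\<^sub>R z) - apply_bcontfun f (x + (2 * sqrt s) *\<^sub>R z)"
    have "apply_bcontfun (heat t f) x - apply_bcontfun (heat s f) x
        = (\<integral>z. heat_kernel (1/4) z * ?h z \<partial>lborel)"
      using t s by (simp add: heat_scaled right_diff_distrib integrable_heat_scaled)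
    moreover have "\<bar>?h z\<bar> \<le> e / 2 + 2 * norm f / d * (2 * \<bar>sqrt t - sqrt s\<bar>) * norm z" for z
    proof -
      have "(x + (2 * sqrt t) *\<^sub>R z) - (x + (2 * sqrt s) *\<^sub>R z) = (2 * (sqrt t - sqrt s)) *\<^sub>R z"
        by (simp add: algebra_simps)
      then have "norm ((x + (2 * sqrt t) *\<^sub>R z) - (x + (2 * sqrt s) *\<^sub>R z))
          = 2 * \<bar>sqrt t - sqrt s\<bar> * norm z"
        by (simp only: norm_scaleR abs_mult abs_numeral)
      with modulus[of "x + (2 * sqrt t) *\<^sub>R z" "x + (2 * sqrt s) *\<^sub>R z"] show ?thesis
        by (simp add: mult.assoc)
    qed
    then have "\<bar>\<integral>z. heat_kernel (1/4) z * ?h z \<partial>lborel\<bar> \<le> L t"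
      unfolding L_def m_def by (intro heat_kernel_integral_linear_bound) auto
    ultimately show "dist (apply_bcontfun (heat t f) x) (apply_bcontfun (heat s f) x) \<le> L t"
      by (simp add: dist_real_def)
  qed
  have "(L \<longlongrightarrow> e / 2 + 2 * norm f / d * (2 * \<bar>sqrt s - sqrt s\<bar>) * m) (at s within {0..})"
    unfolding L_def by (intro tendsto_intros)
  then have "(L \<longlongrightarrow> e / 2) (at s within {0..})"
    by simp
  then have "\<forall>\<^sub>F t in at s within {0..}. L t < e"
    by (rule order_tendstoD(2)) (use e in simp)
  moreover have "\<forall>\<^sub>F t in at s within {0..}. t \<in> {0..}"
    by (simp add: eventually_at_filter)
  ultimately show "\<forall>\<^sub>F t in at s within {0..}. dist (heat t f) (heat s f) < e"
    by eventually_elim (use bound in force)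
qed

text \<open>Contractivity upgrades strong continuity to joint continuity, which makes the integrands in
Duhamel's formula continuous.\<close>

lemma continuous_on_heat:
  fixes r :: "'a::topological_space \<Rightarrow> real" and g :: "'a \<Rightarrow> (real ^ 'n) \<Rightarrow>\<^sub>C real"
  assumes r: "continuous_on S r" "\<And>s. s \<in> S \<Longrightarrow> r s \<ge> 0"
    and g: "continuous_on S g" "\<And>s. s \<in> S \<Longrightarrow> g s \<in> C0"
  shows "continuous_on S (\<lambda>s. heat (r s) (g s))"
  unfolding continuous_on_def
proof
  fix a
  assume a: "a \<in> S"
  have "((\<lambda>s. heat (r s) (g a)) \<longlongrightarrow> heat (r a) (g a)) (at a within S)"
    using continuous_on_compose2[OF continuous_on_heat_time[OF g(2)[OF a]] r(1)] r(2) a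
    by (auto simp: continuous_on_def)
  moreover have "((\<lambda>s. heat (r s) (g s) - heat (r s) (g a)) \<longlongrightarrow> 0) (at a within S)"
  proof (rule Lim_null_comparison)
    have "\<forall>\<^sub>F s in at a within S. s \<in> S"
      by (simp add: eventually_at_filter)
    then show "\<forall>\<^sub>F s in at a within S. norm (heat (r s) (g s) - heat (r s) (g a)) \<le> norm (g s - g a)"
      by eventually_elim
        (simp add: r norm_heat_le flip: heat_diff)
    show "((\<lambda>s. norm (g s - g a)) \<longlongrightarrow> 0) (at a within S)"
      using g(1) a by (auto simp: continuous_on_def intro!: tendsto_norm_zero LIM_zero)
  qed
  ultimately have "((\<lambda>s. heat (r s) (g s) - heat (r s) (g a) + heat (r s) (g a))
      \<longlongrightarrow> 0 + heat (r a) (g a)) (at a within S)"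
    by (intro tendsto_add)
  then show "((\<lambda>s. heat (r s) (g s)) \<longlongrightarrow> heat (r a) (g a)) (at a within S)"
    by simp
qed

section \<open>Duhamel integrals and the nonlinearity\<close>

instance bcontfun :: (metric_space, banach) banach ..

lemma subspace_C0: "subspace (C0 :: ((real ^ 'n) \<Rightarrow>\<^sub>C real) set)"
proof (rule subspaceI)
  show "f + g \<in> C0" if "f \<in> C0" "g \<in> C0" for f g :: "(real ^ 'n) \<Rightarrow>\<^sub>C real"
    using tendsto_add[of "apply_bcontfun f" 0 at_infinity "apply_bcontfun g" 0] that
    by (simp add: C0_def)
  show "c *\<^sub>R f \<in> C0" if "f \<in> C0" for c and f :: "(real ^ 'n) \<Rightarrow>\<^sub>C real"
    using tendsto_mult_right_zero[of "apply_bcontfun f" at_infinity c] that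
    by (simp add: C0_def)
qed (simp add: C0_def)

lemma closed_C0: "closed (C0 :: ((real ^ 'n) \<Rightarrow>\<^sub>C real) set)"
proof -
  have "f \<in> C0" if f: "f \<in> closure C0" for f :: "(real ^ 'n) \<Rightarrow>\<^sub>C real"
  proof (rule C0I)
    fix e :: real
    assume e: "e > 0"
    obtain g where g: "g \<in> C0" "dist g f < e / 2"
      using f e unfolding closure_approachable by (meson half_gt_zero)
    obtain R where R: "\<And>x. norm x \<ge> R \<Longrightarrow> \<bar>apply_bcontfun g x\<bar> < e / 2"
      using C0_eventually[OF g(1), of "e / 2"] e by auto
    have "\<bar>apply_bcontfun f x\<bar> \<le> e" if "norm x \<ge> R" for x
      using R[OF that] dist_bounded[of g x f] g(2) by (simp add: dist_real_def)
    then show "\<exists>R. \<forall>x. norm x \<ge> R \<longrightarrow> \<bar>apply_bcontfun f x\<bar> \<le> e"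
      by blast
  qed
  then show ?thesis
    unfolding closure_subset_eq[symmetric] by blast
qed

text \<open>Riemann sums stay in the subspace, and the integral is a limit of them.\<close>

lemma integral_in_closed_subspace:
  fixes f :: "real \<Rightarrow> 'a::banach"
  assumes S: "subspace S" "closed S"
    and f: "f integrable_on {a..b}" "\<And>s. s \<in> {a..b} \<Longrightarrow> f s \<in> S"
  shows "integral {a..b} f \<in> S"
proof -
  have "integral {a..b} f \<in> closure S"
    unfolding closure_approachable
  proof (intro allI impI)
    fix e :: real
    assume e: "e > 0"
    obtain \<gamma> where \<gamma>: "gauge \<gamma>" "\<And>\<D>. \<D> tagged_division_of {a..b} \<Longrightarrow> \<gamma> fine \<D> \<Longrightarrow>
        norm ((\<Sum>(x, k)\<in>\<D>. measure lborel k *\<^sub>R f x) - integral {a..b} f) < e"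
      using integrable_integral[OF f(1)] e unfolding has_integral_real by metis
    obtain \<D> where \<D>: "\<D> tagged_division_of {a..b}" "\<gamma> fine \<D>"
      using fine_division_exists_real[OF \<gamma>(1)] .
    have "(\<Sum>(x, k)\<in>\<D>. measure lborel k *\<^sub>R f x) \<in> S"
      using tag_in_interval[OF \<D>(1)[unfolded box_real(2)[symmetric]]] f(2)
      by (intro subspace_sum S) (auto intro!: subspace_scale S)
    with \<gamma>(2)[OF \<D>] show "\<exists>y\<in>S. dist y (integral {a..b} f) < e"
      by (auto simp: dist_norm)
  qed
  then show ?thesis
    using S(2) by simp
qed

text \<open>Both the domain of integration and the integrand vary with \<open>t\<close>. Extending the integrand by
\<open>heat 0 (g s) = g s\<close> to \<open>s > t\<close> keeps it jointly continuous and fixes the domain; the added part is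
an integral of \<open>g\<close> alone.\<close>

lemma continuous_on_heat_convolution:
  fixes g :: "real \<Rightarrow> (real ^ 'n) \<Rightarrow>\<^sub>C real"
  assumes g: "continuous_on {a..b} g" "\<And>s. s \<in> {a..b} \<Longrightarrow> g s \<in> C0"
  shows "continuous_on {a..b} (\<lambda>t. integral {a..t} (\<lambda>s. heat (t - s) (g s)))"
proof -
  define h where "h t s = heat (max 0 (t - s)) (g s)" for t s
  have "continuous_on ({a..b} \<times> cbox a b) (\<lambda>(t, s). h t s)"
    unfolding h_def split_beta
    by (intro continuous_on_heat continuous_intros continuous_on_compose2[OF g(1)]) (auto simp: g)
  then have "continuous_on {a..b} (\<lambda>t. integral {a..b} (h t))"
    using integral_continuous_on_param[of "{a..b}" a b h] by simp
  moreover have "continuous_on {a..b} (\<lambda>t. integral {t..b} g)"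
    by (intro indefinite_integral_continuous_1' integrable_continuous_real g)
  ultimately have "continuous_on {a..b} (\<lambda>t. integral {a..b} (h t) - integral {t..b} g)"
    by (rule continuous_on_diff)
  also have "?this \<longleftrightarrow> continuous_on {a..b} (\<lambda>t. integral {a..t} (\<lambda>s. heat (t - s) (g s)))"
  proof (rule continuous_on_cong)
    fix t
    assume t: "t \<in> {a..b}"
    have "h t integrable_on {a..b}"
      unfolding h_def
      by (intro integrable_continuous_real continuous_on_heat continuous_intros g) (auto simp: g)
    then have "integral {a..b} (h t) = integral {a..t} (h t) + integral {t..b} (h t)"
      using t by (simp add: Henstock_Kurzweil_Integration.integral_combine)
    moreover have "integral {t..b} (h t) = integral {t..b} g"
      by (rule integral_cong) (simp add: h_def)
    moreover have "integral {a..t} (h t) = integral {a..t} (\<lambda>s. heat (t - s) (g s))"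
      by (rule integral_cong) (simp add: h_def)
    ultimately show "integral {a..b} (h t) - integral {t..b} g = integral {a..t} (\<lambda>s. heat (t - s) (g s))"
      by simp
  qed simp
  finally show ?thesis .
qed

lemma continuous_on_heat_integrand:
  fixes g :: "real \<Rightarrow> (real ^ 'n) \<Rightarrow>\<^sub>C real"
  assumes "continuous_on {a..b} g" "\<And>s. s \<in> {a..b} \<Longrightarrow> g s \<in> C0" "b \<le> t"
  shows "continuous_on {a..b} (\<lambda>s. heat (t - s) (g s))"
  using assms by (intro continuous_on_heat continuous_intros) auto

lemma abs_powr_apply: "p > 0 \<Longrightarrow> apply_bcontfun (abs_powr p f) x = \<bar>apply_bcontfun f x\<bar> powr p"
  by (simp add: abs_powr.rep_eq)

lemma abs_powr_in_C0:
  assumes "p > 0" "f \<in> C0"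
  shows "abs_powr p f \<in> C0"
proof -
  have "((\<lambda>x. \<bar>apply_bcontfun f x\<bar> powr p) \<longlongrightarrow> \<bar>0\<bar> powr p) at_infinity"
    using assms by (intro tendsto_powr' tendsto_rabs tendsto_const) (auto simp: C0_def)
  then show ?thesis
    using assms by (simp add: C0_def abs_powr.rep_eq)
qed

lemma powr_mean_value:
  fixes a b p :: real
  assumes p: "p > 1" and ab: "0 \<le> a" "a \<le> b"
  obtains z where "a \<le> z" "z \<le> b" "b powr p - a powr p = p * z powr (p - 1) * (b - a)"
proof (cases "a = b")
  case False
  with ab have "a < b" by simp
  moreover have "continuous_on {a..b} (\<lambda>x. x powr p)"
    using p ab by (intro continuous_on_powr' continuous_intros) auto
  moreover have deriv: "((\<lambda>x. x powr p) has_real_derivative p * x powr (p - 1)) (at x)" if "a < x" for x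
    using that ab by (intro has_real_derivative_powr) auto
  then have "(\<lambda>x. x powr p) differentiable (at x)" if "a < x" for x
    using that real_differentiable_def by blast
  ultimately obtain l z where z: "a < z" "z < b" "DERIV (\<lambda>x. x powr p) z :> l"
    "b powr p - a powr p = (b - a) * l"
    using MVT[of a b "\<lambda>x. x powr p"] by blast
  have "l = p * z powr (p - 1)"
    using DERIV_unique[OF z(3) deriv] z by simp
  with z show ?thesis
    by (intro that[of z]) (auto simp: mult.commute)
qed (auto intro: that)

lemma powr_diff_le:
  fixes a b M p :: real
  assumes p: "p > 1" and ab: "0 \<le> a" "a \<le> b" "b \<le> M"
  shows "b powr p - a powr p \<le> p * M powr (p - 1) * (b - a)"
proof -
  obtain z where z: "a \<le> z" "z \<le> b" "b powr p - a powr p = p * z powr (p - 1) * (b - a)"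
    using powr_mean_value[OF p ab(1,2)] .
  have "z powr (p - 1) \<le> M powr (p - 1)"
    using p ab z by (intro powr_mono2) auto
  then show ?thesis
    using p ab z by (auto intro!: mult_right_mono)
qed

text \<open>Convexity of \<open>x \<mapsto> x powr p\<close> on the closed half-line, as needed for Jensen's inequality.\<close>

lemma powr_above_tangent:
  fixes a m p :: real
  assumes p: "p > 1" and "a \<ge> 0" "m \<ge> 0"
  shows "m powr p + p * m powr (p - 1) * (a - m) \<le> a powr p"
proof (cases "m \<le> a")
  case True
  obtain z where z: "m \<le> z" "z \<le> a" "a powr p - m powr p = p * z powr (p - 1) * (a - m)"
    using powr_mean_value[OF p _ True] assms by auto
  have "m powr (p - 1) \<le> z powr (p - 1)"
    using p assms z by (intro powr_mono2) auto
  then have "p * m powr (p - 1) * (a - m) \<le> p * z powr (p - 1) * (a - m)"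
    using p True by (auto intro!: mult_right_mono)
  then show ?thesis
    using z by simp
next
  case False
  then have "m powr p - a powr p \<le> p * m powr (p - 1) * (m - a)"
    using assms by (intro powr_diff_le) auto
  then show ?thesis
    by (simp add: algebra_simps)
qed

lemma abs_powr_Lipschitz:
  assumes p: "p > 1" and "norm f \<le> M" "norm g \<le> M"
  shows "norm (abs_powr p f - abs_powr p g) \<le> p * M powr (p - 1) * norm (f - g)"
proof (rule norm_bound)
  fix x
  have *: "\<bar>\<bar>u\<bar> powr p - \<bar>v\<bar> powr p\<bar> \<le> p * M powr (p - 1) * \<bar>u - v\<bar>"
    if "\<bar>u\<bar> \<le> M" "\<bar>v\<bar> \<le> M" "\<bar>u\<bar> \<le> \<bar>v\<bar>" for u v :: real
  proof -
    have "\<bar>u\<bar> powr p \<le> \<bar>v\<bar> powr p"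
      using that p by (intro powr_mono2) auto
    moreover have "\<bar>v\<bar> powr p - \<bar>u\<bar> powr p \<le> p * M powr (p - 1) * (\<bar>v\<bar> - \<bar>u\<bar>)"
      using that by (intro powr_diff_le p) auto
    moreover have "\<dots> \<le> p * M powr (p - 1) * \<bar>u - v\<bar>"
      using p by (intro mult_left_mono) auto
    ultimately show ?thesis by linarith
  qed
  have fg: "\<bar>apply_bcontfun f x\<bar> \<le> M" "\<bar>apply_bcontfun g x\<bar> \<le> M"
    using norm_bounded[of f x] norm_bounded[of g x] assms by auto
  have "\<bar>\<bar>apply_bcontfun f x\<bar> powr p - \<bar>apply_bcontfun g x\<bar> powr p\<bar>
      \<le> p * M powr (p - 1) * \<bar>apply_bcontfun f x - apply_bcontfun g x\<bar>"
    using *[OF fg] *[OF fg(2,1)] by (metis abs_minus_commute linear)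
  also have "\<dots> \<le> p * M powr (p - 1) * norm (f - g)"
    using p norm_bounded[of "f - g" x] by (intro mult_left_mono) auto
  finally show "norm (apply_bcontfun (abs_powr p f - abs_powr p g) x) \<le> p * M powr (p - 1) * norm (f - g)"
    using p by (simp add: abs_powr_apply)
qed

lemma norm_abs_powr_le:
  assumes "p > 0" "norm f \<le> M"
  shows "norm (abs_powr p f) \<le> M powr p"
proof (rule norm_bound)
  fix x
  show "norm (apply_bcontfun (abs_powr p f) x) \<le> M powr p"
    using assms norm_bounded[of f x] by (auto simp: abs_powr_apply intro!: powr_mono2)
qed

lemma continuous_on_abs_powr:
  fixes f :: "'a::topological_space \<Rightarrow> (real ^ 'n) \<Rightarrow>\<^sub>C real"
  assumes p: "p > 1" and f: "continuous_on S f"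
  shows "continuous_on S (\<lambda>s. abs_powr p (f s))"
proof (rule continuous_on_compose2[OF _ f subset_UNIV])
  show "continuous_on UNIV (abs_powr p :: ((real ^ 'n) \<Rightarrow>\<^sub>C real) \<Rightarrow> _)"
    unfolding continuous_on_def
  proof
    fix g :: "(real ^ 'n) \<Rightarrow>\<^sub>C real"
    have "\<forall>\<^sub>F h in at g. dist h g < 1"
      by (auto simp: eventually_at intro: exI[of _ 1])
    then have "\<forall>\<^sub>F h in at g. norm (abs_powr p h - abs_powr p g)
        \<le> p * (norm g + 1) powr (p - 1) * norm (h - g)"
    proof eventually_elim
      case (elim h)
      then have "norm h \<le> norm g + 1"
        using norm_triangle_ineq2[of h g] by (simp add: dist_norm)
      then show ?case
        by (intro abs_powr_Lipschitz p) auto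
    qed
    moreover have "((\<lambda>h. p * (norm g + 1) powr (p - 1) * norm (h - g)) \<longlongrightarrow> 0) (at g)"
      by (intro tendsto_mult_right_zero tendsto_norm_zero LIM_zero tendsto_ident_at)
    ultimately have "((\<lambda>h. abs_powr p h - abs_powr p g) \<longlongrightarrow> 0) (at g)"
      by (rule Lim_null_comparison)
    then show "(abs_powr p \<longlongrightarrow> abs_powr p g) (at g within UNIV)"
      by (rule LIM_zero_cancel)
  qed
qed

abbreviation source ::
  "real \<Rightarrow> real \<Rightarrow> ((real ^ 'n) \<Rightarrow>\<^sub>C real) \<Rightarrow> real \<Rightarrow> ((real ^ 'n) \<Rightarrow>\<^sub>C real) \<Rightarrow> ((real ^ 'n) \<Rightarrow>\<^sub>C real)"
  where "source p \<sigma> w s v \<equiv> abs_powr p v + (s powr \<sigma>) *\<^sub>R w"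

lemma source_in_C0: "p > 1 \<Longrightarrow> w \<in> C0 \<Longrightarrow> v \<in> C0 \<Longrightarrow> source p \<sigma> w s v \<in> C0"
  by (intro subspace_add subspace_scale subspace_C0 abs_powr_in_C0) auto

lemma continuous_on_source:
  assumes "p > 1" "\<sigma> > 0" "continuous_on S u" "S \<subseteq> {0..}"
  shows "continuous_on S (\<lambda>s. source p \<sigma> w s (u s))"
  using assms by (intro continuous_intros continuous_on_abs_powr continuous_on_powr') auto

lemma continuous_on_heat_source:
  fixes u :: "real \<Rightarrow> (real ^ 'n) \<Rightarrow>\<^sub>C real"
  assumes "p > 1" "\<sigma> > 0" "w \<in> C0" "0 \<le> a" "b \<le> t"
    and "continuous_on {a..b} u" "\<And>s. s \<in> {a..b} \<Longrightarrow> u s \<in> C0"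
  shows "continuous_on {a..b} (\<lambda>s. heat (t - s) (source p \<sigma> w s (u s)))"
  using assms by (intro continuous_on_heat_integrand continuous_on_source source_in_C0) auto

section \<open>Existence, uniqueness and continuation\<close>

lemma solution_on_subinterval:
  "solution_on p \<sigma> w u0 T u \<Longrightarrow> T' \<le> T \<Longrightarrow> solution_on p \<sigma> w u0 T' u"
  unfolding solution_on_def by (auto intro: continuous_on_subset)

lemma solution_on_cong:
  assumes "\<And>t. t \<in> {0..T} \<Longrightarrow> u t = v t"
  shows "solution_on p \<sigma> w u0 T u \<longleftrightarrow> solution_on p \<sigma> w u0 T v"
proof -
  have "integral {0..t} (\<lambda>s. heat (t - s) (source p \<sigma> w s (u s)))
      = integral {0..t} (\<lambda>s. heat (t - s) (source p \<sigma> w s (v s)))" if "t \<in> {0..T}" for t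
    using that assms by (intro integral_cong) auto
  moreover have "continuous_on {0..T} u \<longleftrightarrow> continuous_on {0..T} v"
    using assms by (intro continuous_on_cong) auto
  ultimately show ?thesis
    using assms by (auto simp: solution_on_def)
qed

text \<open>The homogeneous case of Gronwall's inequality: the function \<open>exp (- L t) D t\<close>, with \<open>D\<close> the integral
of \<open>d\<close>, is nonincreasing and vanishes at \<open>0\<close>.\<close>

lemma Gronwall_zero:
  fixes d :: "real \<Rightarrow> real"
  assumes d: "continuous_on {0..T} d" "\<And>t. t \<in> {0..T} \<Longrightarrow> d t \<le> L * integral {0..t} d"
    and nonneg: "\<And>t. t \<in> {0..T} \<Longrightarrow> d t \<ge> 0" and L: "L \<ge> 0" and t: "t \<in> {0..T}"
  shows "d t = 0"
proof -
  define D where "D t = integral {0..t} d" for t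
  have D: "(D has_real_derivative d x) (at x within {0..T})" if "x \<in> {0..T}" for x
    unfolding D_def by (rule integral_has_real_derivative[OF d(1) that])
  have "exp (- L * t) * D t \<le> exp (- L * 0) * D 0"
  proof (rule DERIV_nonpos_imp_decreasing_open[where f = "\<lambda>x. exp (- L * x) * D x"])
    show "continuous_on {0..t} (\<lambda>x. exp (- L * x) * D x)"
      using t unfolding D_def
      by (intro continuous_intros indefinite_integral_continuous_1 integrable_continuous_real
          continuous_on_subset[OF d(1)]) auto
    fix x
    assume x: "0 < x" "x < t"
    then have "(D has_real_derivative d x) (at x)"
      using D[of x] t at_within_interior[of x "{0..T}"] by simp
    then have "((\<lambda>x. exp (- L * x) * D x) has_real_derivative exp (- L * x) * (d x - L * D x)) (at x)"
      by (auto intro!: derivative_eq_intros simp: algebra_simps)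
    moreover have "exp (- L * x) * (d x - L * D x) \<le> 0"
      using d(2)[of x] x t by (intro mult_nonneg_nonpos) (auto simp: D_def)
    ultimately show "\<exists>y. ((\<lambda>x. exp (- L * x) * D x) has_real_derivative y) (at x) \<and> y \<le> 0"
      by blast
  qed (use t in auto)
  then have "exp (- L * t) * D t \<le> 0"
    by (simp add: D_def)
  then have "D t \<le> 0"
    by (simp add: mult_le_0_iff not_le[symmetric])
  then have "d t \<le> 0"
    using d(2)[OF t] L by (simp add: D_def) (smt (verit) mult_nonneg_nonpos)
  then show ?thesis
    using nonneg[OF t] by simp
qed

lemma solution_unique:
  fixes u v :: "real \<Rightarrow> (real ^ 'n) \<Rightarrow>\<^sub>C real"
  assumes p: "p > 1" and \<sigma>: "\<sigma> > 0" and w: "w \<in> C0"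
    and u: "solution_on p \<sigma> w u0 T u" and v: "solution_on p \<sigma> w u0 T v" and t: "t \<in> {0..T}"
  shows "u t = v t"
proof -
  have cont: "continuous_on {0..T} u" "continuous_on {0..T} v"
    and C0: "\<And>s. s \<in> {0..T} \<Longrightarrow> u s \<in> C0" "\<And>s. s \<in> {0..T} \<Longrightarrow> v s \<in> C0"
    using u v by (auto simp: solution_on_def)
  have "bounded (u ` {0..T} \<union> v ` {0..T})"
    using cont by (auto intro!: compact_imp_bounded compact_continuous_image)
  then obtain M where M: "\<And>s. s \<in> {0..T} \<Longrightarrow> norm (u s) \<le> M" "\<And>s. s \<in> {0..T} \<Longrightarrow> norm (v s) \<le> M"
    unfolding bounded_iff by blast
  define L where "L = p * M powr (p - 1)"
  have "norm (u t - v t) \<le> L * integral {0..t} (\<lambda>s. norm (u s - v s))" if t: "t \<in> {0..T}" for t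
  proof -
    let ?g = "\<lambda>u s. heat (t - s) (source p \<sigma> w s (u s))"
    have int: "?g u integrable_on {0..t}" "?g v integrable_on {0..t}"
      using t C0 by (auto intro!: integrable_continuous_real continuous_on_heat_source p \<sigma> w
          continuous_on_subset[OF cont(1)] continuous_on_subset[OF cont(2)])
    have "u t - v t = integral {0..t} (\<lambda>s. ?g u s - ?g v s)"
      using u v t by (simp add: solution_on_def integral_diff[OF int])
    also have "norm \<dots> \<le> integral {0..t} (\<lambda>s. L * norm (u s - v s))"
    proof (rule Henstock_Kurzweil_Integration.integral_norm_bound_integral)
      show "(\<lambda>s. ?g u s - ?g v s) integrable_on {0..t}"
        using int by (rule integrable_diff)
      show "(\<lambda>s. L * norm (u s - v s)) integrable_on {0..t}"
        using t by (intro integrable_continuous_real continuous_intros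
            continuous_on_subset[OF cont(1)] continuous_on_subset[OF cont(2)]) auto
      fix s
      assume s: "s \<in> {0..t}"
      have "?g u s - ?g v s = heat (t - s) (abs_powr p (u s) - abs_powr p (v s))"
        using s by (simp flip: heat_diff)
      then have "norm (?g u s - ?g v s) \<le> norm (abs_powr p (u s) - abs_powr p (v s))"
        using s by (simp add: norm_heat_le)
      also have "\<dots> \<le> L * norm (u s - v s)"
        unfolding L_def using s t by (intro abs_powr_Lipschitz p M) auto
      finally show "norm (?g u s - ?g v s) \<le> L * norm (u s - v s)" .
    qed
    finally show ?thesis
      by simp
  qed
  then have "norm (u t - v t) = 0"
    by (intro Gronwall_zero[of T "\<lambda>s. norm (u s - v s)" L] continuous_intros cont t)
      (use p in \<open>auto simp: L_def\<close>)
  then show ?thesis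
    by simp
qed

text \<open>The contraction principle for continuous functions on \<open>[a,b]\<close> with values in a closed set. A
function on \<open>[a,b]\<close> is represented by its extension to the real line that is constant outside
\<open>[a,b]\<close>, so that the complete space of bounded continuous functions can be used.\<close>

lemma fixed_point_on_interval:
  fixes \<Psi> :: "(real \<Rightarrow> 'a) \<Rightarrow> real \<Rightarrow> 'a::banach"
  assumes ab: "a \<le> b" and K: "closed K" "K \<noteq> {}" and c: "0 \<le> c" "c < 1"
    and cont: "\<And>v. continuous_on {a..b} v \<Longrightarrow> v ` {a..b} \<subseteq> K \<Longrightarrow> continuous_on {a..b} (\<Psi> v)"
    and maps: "\<And>v t. continuous_on {a..b} v \<Longrightarrow> v ` {a..b} \<subseteq> K \<Longrightarrow> t \<in> {a..b} \<Longrightarrow> \<Psi> v t \<in> K"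
    and contraction: "\<And>u v t e. continuous_on {a..b} u \<Longrightarrow> u ` {a..b} \<subseteq> K \<Longrightarrow>
      continuous_on {a..b} v \<Longrightarrow> v ` {a..b} \<subseteq> K \<Longrightarrow> (\<And>s. s \<in> {a..b} \<Longrightarrow> dist (u s) (v s) \<le> e) \<Longrightarrow>
      t \<in> {a..b} \<Longrightarrow> dist (\<Psi> u t) (\<Psi> v t) \<le> c * e"
  obtains v where "continuous_on {a..b} v" "v ` {a..b} \<subseteq> K" "\<And>t. t \<in> {a..b} \<Longrightarrow> v t = \<Psi> v t"
proof -
  define S where "S = (PiC UNIV (\<lambda>_. K) :: (real \<Rightarrow>\<^sub>C 'a) set)"
  have S: "f \<in> S \<longleftrightarrow> range (apply_bcontfun f) \<subseteq> K" for f
    by (auto simp: S_def mem_PiC_iff)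
  have clamp: "clamp a b t \<in> {a..b}" for t
    using clamp_in_interval[of a b t] ab by simp
  have "\<exists>g. \<forall>t. apply_bcontfun g t = \<Psi> (apply_bcontfun f) (clamp a b t)" if "f \<in> S" for f
  proof -
    have "continuous_on (cbox a b) (\<Psi> (apply_bcontfun f))"
      using that by (simp add: cont S image_subset_iff)
    then show ?thesis
      by (rule continuous_on_cbox_bcontfunE) blast
  qed
  then obtain \<Phi> where \<Phi>: "\<And>f t. f \<in> S \<Longrightarrow> apply_bcontfun (\<Phi> f) t = \<Psi> (apply_bcontfun f) (clamp a b t)"
    by metis
  have "\<exists>!f\<in>S. \<Phi> f = f"
  proof (rule Banach_fix)
    show "complete S"
      unfolding complete_eq_closed S_def by (intro closed_PiC K)
    obtain k where "k \<in> K"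
      using K by auto
    then have "const_bcontfun k \<in> S"
      by (auto simp: S)
    then show "S \<noteq> {}"
      by auto
    show "\<Phi> ` S \<subseteq> S"
      using clamp by (auto simp: S \<Phi> image_subset_iff intro!: maps)
    show "dist (\<Phi> f) (\<Phi> g) \<le> c * dist f g" if "f \<in> S" "g \<in> S" for f g
      using that clamp
      by (intro dist_bound) (auto simp: \<Phi> S image_subset_iff intro!: contraction dist_bounded)
  qed (use c in auto)
  then obtain f where f: "f \<in> S" "\<Phi> f = f"
    by blast
  show ?thesis
  proof (rule that[of "apply_bcontfun f"])
    show "apply_bcontfun f t = \<Psi> (apply_bcontfun f) t" if "t \<in> {a..b}" for t
      using \<Phi>[OF f(1), of t] that by (simp add: f(2))
  qed (use f(1) in \<open>auto simp: S\<close>)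
qed

text \<open>One \<open>\<delta>\<close> serves all initial times and all initial values within the given bounds. This uniformity is
what the blow-up alternative rests on.\<close>

lemma local_existence:
  fixes w :: "(real ^ 'n) \<Rightarrow>\<^sub>C real"
  assumes p: "p > 1" and \<sigma>: "\<sigma> > 0" and w: "w \<in> C0" and R: "R \<ge> 0" and B: "B \<ge> 0"
  shows "\<exists>\<delta>>0. \<forall>a b \<phi>. 0 \<le> a \<and> a \<le> b \<and> b \<le> a + \<delta> \<and> b \<le> B \<and> \<phi> \<in> C0 \<and> norm \<phi> \<le> R \<longrightarrow>
    (\<exists>v. continuous_on {a..b} v \<and> (\<forall>t\<in>{a..b}. v t \<in> C0 \<and>
      v t = heat (t - a) \<phi> + integral {a..t} (\<lambda>s. heat (t - s) (source p \<sigma> w s (v s)))))"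
proof -
  \<comment> \<open>The iteration runs in the ball of radius \<open>M\<close>; there \<open>Q\<close> bounds the source and \<open>L\<close> is a Lipschitz
    constant. The choice of \<open>\<delta>\<close> limits the Duhamel integral to norm \<open>1\<close> and the contraction factor
    to \<open>1/2\<close>.\<close>
  define M where "M = R + 1"
  define Q where "Q = M powr p + B powr \<sigma> * norm w"
  define L where "L = p * M powr (p - 1)"
  have nonneg: "Q \<ge> 0" "L \<ge> 0"
    using p by (auto simp: Q_def L_def)
  define \<delta> where "\<delta> = 1 / (Q + 2 * L + 1)"
  have \<delta>: "\<delta> > 0" "\<delta> * Q \<le> 1" "\<delta> * L \<le> 1 / 2"
    using nonneg by (auto simp: \<delta>_def field_simps)
  have "\<exists>v. continuous_on {a..b} v \<and> (\<forall>t\<in>{a..b}. v t \<in> C0 \<and>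
      v t = heat (t - a) \<phi> + integral {a..t} (\<lambda>s. heat (t - s) (source p \<sigma> w s (v s))))"
    if a: "0 \<le> a" and ab: "a \<le> b" "b \<le> a + \<delta>" and b: "b \<le> B" and \<phi>: "\<phi> \<in> C0" "norm \<phi> \<le> R"
    for a b and \<phi> :: "(real ^ 'n) \<Rightarrow>\<^sub>C real"
  proof -
    let ?g = "\<lambda>t v s. heat (t - s) (source p \<sigma> w s (v s))"
    define \<Psi> where "\<Psi> v t = heat (t - a) \<phi> + integral {a..t} (?g t v)" for v t
    let ?K = "(C0 :: ((real ^ 'n) \<Rightarrow>\<^sub>C real) set) \<inter> cball 0 M"
    have g_cont: "continuous_on {a..t} (?g t v)"
      if "continuous_on {a..b} v" "v ` {a..b} \<subseteq> ?K" "t \<in> {a..b}" for v t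
      using that a by (intro continuous_on_heat_source p \<sigma> w) (auto intro: continuous_on_subset)
    have g_C0: "?g t v s \<in> C0" if "v ` {a..b} \<subseteq> ?K" "t \<in> {a..b}" "s \<in> {a..t}" for v t s
      using that by (intro heat_in_C0 source_in_C0 p w) auto
    obtain v where v: "continuous_on {a..b} v" "v ` {a..b} \<subseteq> ?K" "\<And>t. t \<in> {a..b} \<Longrightarrow> v t = \<Psi> v t"
    proof (rule fixed_point_on_interval[of a b ?K "1/2" \<Psi>])
      show "closed ?K"
        by (intro closed_Int closed_C0) auto
      have "0 \<in> ?K"
        using R subspace_0[OF subspace_C0] by (simp add: M_def)
      then show "?K \<noteq> {}"
        by blast
    next
      fix v
      assume v: "continuous_on {a..b} v" "v ` {a..b} \<subseteq> ?K"
      show "continuous_on {a..b} (\<Psi> v)"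
        unfolding \<Psi>_def using v a \<phi>(1)
        by (intro continuous_on_add continuous_on_heat_convolution continuous_on_source
            continuous_on_heat p \<sigma> source_in_C0 w continuous_intros) auto
      fix t
      assume t: "t \<in> {a..b}"
      have "\<Psi> v t \<in> C0"
        unfolding \<Psi>_def using t v
        by (intro subspace_add integral_in_closed_subspace subspace_C0 closed_C0 heat_in_C0 \<phi>
            integrable_continuous_real g_cont g_C0) auto
      moreover have "norm (integral {a..t} (?g t v)) \<le> Q * (t - a)"
      proof (rule integral_bound)
        show "continuous_on {a..t} (?g t v)"
          by (rule g_cont[OF v t])
        fix s
        assume s: "s \<in> {a..t}"
        have "norm (?g t v s) \<le> norm (abs_powr p (v s)) + norm ((s powr \<sigma>) *\<^sub>R w)"
          using s by (intro order_trans[OF norm_heat_le norm_triangle_ineq]) auto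
        also have "\<dots> \<le> Q"
          unfolding Q_def using s t v p \<sigma> a b
          by (intro add_mono norm_abs_powr_le)
            (auto simp: image_subset_iff intro!: mult_right_mono powr_mono2)
        finally show "norm (?g t v s) \<le> Q" .
      qed (use t in auto)
      moreover have "Q * (t - a) \<le> Q * \<delta>"
        using t ab nonneg by (intro mult_left_mono) auto
      moreover have "norm (heat (t - a) \<phi>) \<le> R"
        using norm_heat_le[of "t - a" \<phi>] \<phi> t by simp
      ultimately show "\<Psi> v t \<in> ?K"
        using \<delta>(2) norm_triangle_ineq[of "heat (t - a) \<phi>" "integral {a..t} (?g t v)"]
        by (simp add: \<Psi>_def M_def mult.commute)
    next
      fix u v t e
      assume u: "continuous_on {a..b} u" "u ` {a..b} \<subseteq> ?K" and v: "continuous_on {a..b} v" "v ` {a..b} \<subseteq> ?K"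
        and e: "\<And>s. s \<in> {a..b} \<Longrightarrow> dist (u s) (v s) \<le> e" and t: "t \<in> {a..b}"
      have "0 \<le> dist (u t) (v t)"
        by simp
      also have "\<dots> \<le> e"
        by (rule e[OF t])
      finally have e0: "e \<ge> 0" .
      have "\<Psi> u t - \<Psi> v t = integral {a..t} (\<lambda>s. ?g t u s - ?g t v s)"
        unfolding \<Psi>_def
        by (subst integral_diff) (auto intro!: integrable_continuous_real g_cont u v t)
      also have "norm \<dots> \<le> (L * e) * (t - a)"
      proof (rule integral_bound)
        show "continuous_on {a..t} (\<lambda>s. ?g t u s - ?g t v s)"
          by (intro continuous_on_diff g_cont u v t)
        fix s
        assume s: "s \<in> {a..t}"
        have "?g t u s - ?g t v s = heat (t - s) (abs_powr p (u s) - abs_powr p (v s))"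
          using s by (simp flip: heat_diff)
        then have "norm (?g t u s - ?g t v s) \<le> norm (abs_powr p (u s) - abs_powr p (v s))"
          using s by (simp add: norm_heat_le)
        also have "\<dots> \<le> L * norm (u s - v s)"
          unfolding L_def using s t u v by (intro abs_powr_Lipschitz p) (auto simp: image_subset_iff)
        also have "\<dots> \<le> L * e"
          using e[of s] s t nonneg by (intro mult_left_mono) (auto simp: dist_norm)
        finally show "norm (?g t u s - ?g t v s) \<le> L * e" .
      qed (use t in auto)
      also have "\<dots> \<le> (L * e) * \<delta>"
        using t ab nonneg e0 by (intro mult_left_mono) auto
      also have "\<dots> = (\<delta> * L) * e"
        by simp
      also have "\<dots> \<le> 1 / 2 * e"
        using \<delta>(3) e0 by (intro mult_right_mono)
      finally show "dist (\<Psi> u t) (\<Psi> v t) \<le> 1 / 2 * e"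
        by (simp add: dist_norm)
    qed (use ab in auto)
    then show ?thesis
      unfolding \<Psi>_def by (intro exI[of _ v]) auto
  qed
  then show ?thesis
    using \<delta>(1) by blast
qed

text \<open>Restarting at time \<open>T\<close> continues the solution, because the semigroup law carries the history
\<open>u T = heat T u0 + \<dots>\<close> forward to time \<open>t\<close>.\<close>

lemma solution_extend:
  fixes u v :: "real \<Rightarrow> (real ^ 'n) \<Rightarrow>\<^sub>C real"
  assumes p: "p > 1" and \<sigma>: "\<sigma> > 0" and w: "w \<in> C0"
    and T: "0 \<le> T" "T \<le> T'" and u: "solution_on p \<sigma> w u0 T u"
    and v: "continuous_on {T..T'} v" "\<And>t. t \<in> {T..T'} \<Longrightarrow> v t \<in> C0"
      "\<And>t. t \<in> {T..T'} \<Longrightarrow>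
        v t = heat (t - T) (u T) + integral {T..t} (\<lambda>s. heat (t - s) (source p \<sigma> w s (v s)))"
  shows "solution_on p \<sigma> w u0 T' (\<lambda>t. if t \<le> T then u t else v t)"
proof -
  let ?z = "\<lambda>t. if t \<le> T then u t else v t"
  let ?g = "\<lambda>z t s. heat (t - s) (source p \<sigma> w s (z s))"
  have uC: "continuous_on {0..T} u" "\<And>t. t \<in> {0..T} \<Longrightarrow> u t \<in> C0"
    and u_eq: "\<And>t. t \<in> {0..T} \<Longrightarrow> u t = heat t u0 + integral {0..t} (?g u t)"
    using u by (auto simp: solution_on_def)
  have vT: "v T = u T"
    using v(3)[of T] T by simp
  have z_cont: "continuous_on {0..T'} ?z"
  proof (rule continuous_on_cases_le)
    show "continuous_on {t \<in> {0..T'}. t \<le> T} u"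
      by (rule continuous_on_subset[OF uC(1)]) auto
    show "continuous_on {t \<in> {0..T'}. T \<le> t} v"
      by (rule continuous_on_subset[OF v(1)]) auto
  qed (auto simp: vT intro: continuous_intros)
  have z_C0: "?z t \<in> C0" if "t \<in> {0..T'}" for t
    using that uC(2) v(2) by auto
  have "?z t = heat t u0 + integral {0..t} (?g ?z t)" if t: "t \<in> {0..T'}" for t
  proof (cases "t \<le> T")
    case True
    have "integral {0..t} (?g ?z t) = integral {0..t} (?g u t)"
      using True by (intro integral_cong) auto
    then show ?thesis
      using u_eq[of t] True t by simp
  next
    case False
    with t T have tT: "T \<le> t" "t \<in> {T..T'}" "0 \<le> t - T" by auto
    have "?g ?z t integrable_on {0..t}"
      using t z_C0 by (intro integrable_continuous_real continuous_on_heat_source p \<sigma> w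
          continuous_on_subset[OF z_cont]) auto
    then have "integral {0..t} (?g ?z t) = integral {0..T} (?g ?z t) + integral {T..t} (?g ?z t)"
      using T tT by (simp add: Henstock_Kurzweil_Integration.integral_combine)
    moreover have "integral {T..t} (?g ?z t) = integral {T..t} (?g v t)"
      by (intro integral_cong) (auto simp: vT)
    moreover have "integral {0..T} (?g ?z t) = integral {0..T} (heat (t - T) \<circ> ?g u T)"
      using tT by (intro integral_cong) (auto simp: heat_semigroup)
    moreover have "\<dots> = heat (t - T) (integral {0..T} (?g u T))"
      using uC tT by (intro integral_linear bounded_linear_heat integrable_continuous_real
          continuous_on_heat_source p \<sigma> w) auto
    moreover have "heat (t - T) (u T) = heat t u0 + heat (t - T) (integral {0..T} (?g u T))"
      using u_eq[of T] T tT by (simp add: heat_add heat_semigroup)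
    ultimately show ?thesis
      using v(3)[OF tT(2)] False by (simp add: add.assoc)
  qed
  then show ?thesis
    unfolding solution_on_def using z_cont z_C0 by blast
qed

section \<open>Nonexistence of global solutions\<close>

lemma bounded_linear_eval: "bounded_linear (\<lambda>f. apply_bcontfun f x :: real)"
  by (rule bounded_linear_intro[where K = 1])
    (simp_all add: norm_bounded[where 'b = real, unfolded real_norm_def])

text \<open>Jensen's inequality for the heat kernel as a probability density. Integrating the tangent line
inequality at the mean \<open>m\<close> of \<open>|f|\<close> gives it directly, since the linear term has mean zero.\<close>

lemma heat_abs_powr_ge:
  assumes p: "p > 1" and t: "t \<ge> 0"
  shows "\<bar>apply_bcontfun (heat t f) x\<bar> powr p \<le> apply_bcontfun (heat t (abs_powr p f)) x"
proof -
  define m where "m = apply_bcontfun (heat t (abs_powr 1 f)) x"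
  have "apply_bcontfun (heat t f) x \<le> m"
    unfolding m_def by (intro heat_mono t) (simp add: abs_powr_apply)
  moreover have "apply_bcontfun (heat t (- f)) x \<le> m"
    unfolding m_def by (intro heat_mono t) (simp add: abs_powr_apply)
  ultimately have m: "\<bar>apply_bcontfun (heat t f) x\<bar> \<le> m"
    using heat_uminus[OF t, of f] by simp
  define k where "k = p * m powr (p - 1)"
  have "m powr p = apply_bcontfun (heat t (const_bcontfun (m powr p - k * m) + k *\<^sub>R abs_powr 1 f)) x"
    using t by (simp add: heat_add heat_scaleR heat_const m_def)
  also have "\<dots> \<le> apply_bcontfun (heat t (abs_powr p f)) x"
  proof (rule heat_mono[OF t])
    fix y
    show "apply_bcontfun (const_bcontfun (m powr p - k * m) + k *\<^sub>R abs_powr 1 f) y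
        \<le> apply_bcontfun (abs_powr p f) y"
      using powr_above_tangent[OF p, of "\<bar>apply_bcontfun f y\<bar>" m] m p
      by (simp add: abs_powr_apply k_def algebra_simps)
  qed
  finally have "m powr p \<le> apply_bcontfun (heat t (abs_powr p f)) x" .
  moreover have "\<bar>apply_bcontfun (heat t f) x\<bar> powr p \<le> m powr p"
    using m p by (intro powr_mono2) auto
  ultimately show ?thesis
    by linarith
qed

text \<open>Up to the factor \<open>(4\<pi>r)^(-N/2)\<close> the value at \<open>x\<close> converges to the integral of \<open>w\<close>, so it is
eventually positive. A uniform lower bound holds only on bounded time intervals, and an interval of
length one is enough.\<close>

lemma heat_eventually_positive:
  fixes w :: "(real ^ 'n) \<Rightarrow>\<^sub>C real"
  assumes int: "integrable lborel (apply_bcontfun w)"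
    and pos: "(\<integral>x. apply_bcontfun w x \<partial>lborel) > 0"
  obtains \<tau> c where "\<tau> > 0" "c > 0" "\<And>r. r \<ge> \<tau> \<Longrightarrow> apply_bcontfun (heat r w) x \<ge> 0"
    "\<And>r. r \<in> {\<tau>..\<tau> + 1} \<Longrightarrow> apply_bcontfun (heat r w) x \<ge> c"
proof -
  define I where "I = (\<integral>x. apply_bcontfun w x \<partial>lborel)"
  define J where "J r = (\<integral>y. exp (- (norm (x - y))\<^sup>2 / (4 * r)) * apply_bcontfun w y \<partial>lborel)" for r
  have "(J \<longlongrightarrow> I) at_top"
    unfolding J_def I_def
  proof (rule integral_dominated_convergence_at_top)
    show "integrable lborel (\<lambda>y. \<bar>apply_bcontfun w y\<bar>)"
      using int by simp
    have "((\<lambda>r. exp (- (norm (x - y))\<^sup>2 / (4 * r)) * apply_bcontfun w y) \<longlongrightarrow> apply_bcontfun w y) at_top"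
      for y
    proof -
      have "((\<lambda>r. exp (- (norm (x - y))\<^sup>2 / 4 * inverse r) * apply_bcontfun w y)
          \<longlongrightarrow> exp (- (norm (x - y))\<^sup>2 / 4 * 0) * apply_bcontfun w y) at_top"
        by (intro tendsto_intros tendsto_inverse_0_at_top filterlim_ident)
      then show ?thesis
        by (simp add: field_simps)
    qed
    then show "AE y in lborel. ((\<lambda>r. exp (- (norm (x - y))\<^sup>2 / (4 * r)) * apply_bcontfun w y)
        \<longlongrightarrow> apply_bcontfun w y) at_top"
      by simp
    show "\<forall>\<^sub>F r in at_top. AE y in lborel.
        norm (exp (- (norm (x - y))\<^sup>2 / (4 * r)) * apply_bcontfun w y) \<le> \<bar>apply_bcontfun w y\<bar>"
      using eventually_ge_at_top[of 0]
    proof eventually_elim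
      case (elim r)
      then show ?case
        by (auto simp: abs_mult intro!: mult_left_le_one_le)
    qed
  qed measurable
  then have "\<forall>\<^sub>F r in at_top. J r > I / 2"
    using pos by (intro order_tendstoD(1)) (auto simp: I_def)
  then obtain \<tau>0 where \<tau>0: "\<And>r. r \<ge> \<tau>0 \<Longrightarrow> J r > I / 2"
    by (auto simp: eventually_at_top_linorder)
  define \<tau> where "\<tau> = max \<tau>0 1"
  have \<tau>: "\<tau> > 0" "\<tau>0 \<le> \<tau>"
    by (auto simp: \<tau>_def)
  have heat: "apply_bcontfun (heat r w) x = (4 * pi * r) powr (- real CARD('n) / 2) * J r" if "r \<ge> \<tau>" for r
    using that \<tau> by (simp add: heat.rep_eq J_def)
  have I: "I > 0"
    using pos by (simp add: I_def)
  show ?thesis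
  proof (rule that[of \<tau> "(4 * pi * (\<tau> + 1)) powr (- real CARD('n) / 2) * (I / 2)"])
    show "apply_bcontfun (heat r w) x \<ge> 0" if "r \<ge> \<tau>" for r
      using \<tau>0[of r] that \<tau> I by (auto simp: heat intro!: mult_nonneg_nonneg)
    show "(4 * pi * (\<tau> + 1)) powr (- real CARD('n) / 2) * (I / 2) \<le> apply_bcontfun (heat r w) x"
      if "r \<in> {\<tau>..\<tau> + 1}" for r
    proof -
      have "(4 * pi * (\<tau> + 1)) powr (- real CARD('n) / 2) \<le> (4 * pi * r) powr (- real CARD('n) / 2)"
        using that \<tau> by (intro powr_mono2') auto
      moreover have "I / 2 \<le> J r"
        using \<tau>0[of r] that \<tau> by simp
      ultimately have "(4 * pi * (\<tau> + 1)) powr (- real CARD('n) / 2) * (I / 2)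
          \<le> (4 * pi * r) powr (- real CARD('n) / 2) * J r"
        by (rule mult_mono) (use I in auto)
      then show ?thesis
        using heat[of r] that by simp
    qed
  qed (use \<tau> I in auto)
qed

text \<open>On the first half of the unit interval the linear term lifts \<open>v\<close> above a large level \<open>M\<close>. On the
second half \<open>v\<close> dominates \<open>J = M + \<integral>|v|^p\<close>, and \<open>J' \<ge> J^p\<close>, so \<open>J^(1-p)\<close> decreases at
rate at least \<open>p - 1\<close>. Starting from \<open>M^(1-p)\<close> it would become negative in the remaining time.\<close>

lemma superlinear_integral_inequality_blowup:
  fixes p K :: real
  assumes p: "p > 1"
  obtains A0 where "\<And>A a v. \<lbrakk>A \<ge> A0; continuous_on {a..a + 1} v;
    \<And>t. t \<in> {a..a + 1} \<Longrightarrow> v t \<ge> - K + A * (t - a) + integral {a..t} (\<lambda>s. \<bar>v s\<bar> powr p)\<rbrakk> \<Longrightarrow> False"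
proof -
  \<comment> \<open>Half a unit of time lowers \<open>J powr (1 - p)\<close> by \<open>(p - 1) / 2\<close>, twice its initial value for this \<open>M\<close>.\<close>
  define M where "M = ((p - 1) / 4) powr (1 / (1 - p))"
  have M: "M > 0" "M powr (1 - p) = (p - 1) / 4"
    using p by (auto simp: M_def powr_powr)
  have False if A: "A \<ge> 2 * (M + \<bar>K\<bar>)" and v: "continuous_on {a..a + 1} v"
    and ineq: "\<And>t. t \<in> {a..a + 1} \<Longrightarrow> v t \<ge> - K + A * (t - a) + integral {a..t} (\<lambda>s. \<bar>v s\<bar> powr p)"
    for A a v
  proof -
    let ?h = "\<lambda>s. \<bar>v s\<bar> powr p"
    define b where "b = a + 1/2"
    have h: "continuous_on {a..a + 1} ?h"
      using p by (intro continuous_on_powr' continuous_intros v) auto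
    then have h': "continuous_on {b..a + 1} ?h"
      by (rule continuous_on_subset) (auto simp: b_def)
    define J where "J t = M + integral {b..t} ?h" for t
    have v_ge: "v t \<ge> J t" if t: "t \<in> {b..a + 1}" for t
    proof -
      have "?h integrable_on {a..t}"
        using t by (intro integrable_continuous_real continuous_on_subset[OF h]) auto
      then have "integral {a..t} ?h = integral {a..b} ?h + integral {b..t} ?h"
        using t by (simp add: Henstock_Kurzweil_Integration.integral_combine b_def)
      moreover have "integral {a..b} ?h \<ge> 0"
        by (intro Henstock_Kurzweil_Integration.integral_nonneg integrable_continuous_real
            continuous_on_subset[OF h]) (auto simp: b_def)
      moreover have "A * (t - a) \<ge> (2 * (M + \<bar>K\<bar>)) * (1/2)"
        using A M t by (intro mult_mono) (auto simp: b_def)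
      ultimately show ?thesis
        using ineq[of t] t by (auto simp: J_def b_def)
    qed
    have J_pos: "J t > 0" if "t \<in> {b..a + 1}" for t
    proof -
      have "integral {b..t} ?h \<ge> 0"
        using that by (intro Henstock_Kurzweil_Integration.integral_nonneg integrable_continuous_real
            continuous_on_subset[OF h']) auto
      then show ?thesis
        using M by (simp add: J_def)
    qed
    have J_cont: "continuous_on {b..a + 1} J"
      unfolding J_def
      by (intro continuous_intros indefinite_integral_continuous_1 integrable_continuous_real h')
    define H where "H t = J t powr (1 - p) + (p - 1) * t" for t
    have "H (a + 1) \<le> H b"
    proof (rule DERIV_nonpos_imp_decreasing_open[where f = H])
      show "continuous_on {b..a + 1} H"
        unfolding H_def using J_pos by (intro continuous_intros J_cont) force
      fix t
      assume t: "b < t" "t < a + 1"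
      then have "((\<lambda>t. integral {b..t} ?h) has_real_derivative ?h t) (at t)"
        using integral_has_real_derivative[OF h', of t] at_within_interior[of t "{b..a + 1}"] by simp
      then have "(J has_real_derivative ?h t) (at t)"
        unfolding J_def by (auto intro!: derivative_eq_intros)
      then have "(H has_real_derivative (1 - p) * J t powr (- p) * ?h t + (p - 1)) (at t)"
        unfolding H_def using J_pos[of t] t
        by (auto intro!: derivative_eq_intros has_real_derivative_powr[THEN DERIV_chain2] simp: mult.commute)
      moreover have "(1 - p) * J t powr (- p) * ?h t + (p - 1) \<le> 0"
      proof -
        have "J t powr p \<le> ?h t"
          using v_ge[of t] J_pos[of t] t p by (intro powr_mono2) auto
        then have "1 \<le> J t powr (- p) * ?h t"
          using J_pos[of t] t by (simp add: powr_minus field_simps)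
        then have "(p - 1) * 1 \<le> (p - 1) * (J t powr (- p) * ?h t)"
          using p by (intro mult_left_mono) auto
        then show ?thesis
          by (simp add: algebra_simps)
      qed
      ultimately show "\<exists>y. (H has_real_derivative y) (at t) \<and> y \<le> 0"
        by blast
    qed (simp add: b_def)
    then have "J (a + 1) powr (1 - p) + (p - 1) / 2 \<le> M powr (1 - p)"
      by (simp add: H_def b_def J_def field_simps)
    moreover have "J (a + 1) powr (1 - p) \<ge> 0"
      by simp
    moreover have False if "x + (p - 1) / 2 \<le> y" "x \<ge> 0" "y = (p - 1) / 4" for x y
      using that p by (simp add: field_simps)
    ultimately show False
      using M(2) by blast
  qed
  then show ?thesis
    using that by blast
qed

text \<open>The bound on \<open>u0\<close> enters the scalar inequality through its supremum norm only, so the time \<open>T\<close> can be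
chosen in advance, large enough for the slope \<open>c (T-1)^\<sigma>\<close> to exceed the blow-up threshold \<open>A0\<close>.\<close>

lemma no_global_solution:
  fixes w u0 :: "(real ^ 'n) \<Rightarrow>\<^sub>C real"
  assumes p: "p > 1" and \<sigma>: "\<sigma> > 0" and w: "w \<in> C0"
    and int: "integrable lborel (apply_bcontfun w)"
    and pos: "(\<integral>x. apply_bcontfun w x \<partial>lborel) > 0"
  obtains T where "T > 0" "\<And>u. \<not> solution_on p \<sigma> w u0 T u"
proof -
  obtain \<tau> c where \<tau>: "\<tau> > 0" and c: "c > 0"
    and w_nonneg: "\<And>r. r \<ge> \<tau> \<Longrightarrow> apply_bcontfun (heat r w) 0 \<ge> 0"
    and w_ge: "\<And>r. r \<in> {\<tau>..\<tau> + 1} \<Longrightarrow> apply_bcontfun (heat r w) 0 \<ge> c"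
    using heat_eventually_positive[OF int pos, of 0] by blast
  obtain A0 where A0: "\<And>A a v. \<lbrakk>A \<ge> A0; continuous_on {a..a + 1} v;
    \<And>t. t \<in> {a..a + 1} \<Longrightarrow> v t \<ge> - norm u0 + A * (t - a) + integral {a..t} (\<lambda>s. \<bar>v s\<bar> powr p)\<rbrakk> \<Longrightarrow> False"
    using superlinear_integral_inequality_blowup[OF p, of "norm u0"] by blast
  define a where "a = (max A0 1 / c) powr (1 / \<sigma>)"
  have a: "a > 0" "c * a powr \<sigma> \<ge> A0"
    using c \<sigma> by (auto simp: a_def powr_powr)
  define T where "T = a + 1"
  have "\<not> solution_on p \<sigma> w u0 T u" for u
  proof
    assume u: "solution_on p \<sigma> w u0 T u"
    then have uC: "continuous_on {0..T} u" "\<And>t. t \<in> {0..T} \<Longrightarrow> u t \<in> C0"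
      and u_eq: "\<And>t. t \<in> {0..T} \<Longrightarrow>
        u t = heat t u0 + integral {0..t} (\<lambda>s. heat (t - s) (source p \<sigma> w s (u s)))"
      by (auto simp: solution_on_def)
    \<comment> \<open>The backward time \<open>\<rho>\<close> stays above \<open>\<tau>\<close>, and lies in \<open>[\<tau>, \<tau> + 1]\<close> exactly on the last unit of time.\<close>
    define \<rho> where "\<rho> t = T + \<tau> - t" for t
    have \<rho>: "\<rho> t \<ge> \<tau>" if "t \<le> T" for t
      using that by (simp add: \<rho>_def)
    define v where "v t = apply_bcontfun (heat (\<rho> t) (u t)) 0" for t
    define h where "h s = apply_bcontfun (heat (\<rho> s) (source p \<sigma> w s (u s))) 0" for s
    have \<rho>_cont: "continuous_on S \<rho>" for S
      unfolding \<rho>_def by (intro continuous_intros)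
    have v_cont: "continuous_on {0..T} v"
      unfolding v_def using \<rho> \<tau>
      by (intro bounded_linear.continuous_on[OF bounded_linear_eval] continuous_on_heat \<rho>_cont uC) force+
    have h_cont: "continuous_on {0..T} h"
      unfolding h_def using \<rho> \<tau> uC
      by (intro bounded_linear.continuous_on[OF bounded_linear_eval] continuous_on_heat \<rho>_cont
          continuous_on_source source_in_C0 p \<sigma> w) force+
    have v_eq: "v t = apply_bcontfun (heat (T + \<tau>) u0) 0 + integral {0..t} h" if t: "t \<in> {0..T}" for t
    proof -
      let ?g = "\<lambda>s. heat (t - s) (source p \<sigma> w s (u s))"
      let ?e = "\<lambda>f. apply_bcontfun (heat (\<rho> t) f) 0"
      have e: "bounded_linear ?e"
        by (rule bounded_linear_compose[OF bounded_linear_eval bounded_linear_heat])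
          (use \<rho>[of t] t \<tau> in auto)
      have int: "?g integrable_on {0..t}"
        using t uC(2) by (intro integrable_continuous_real continuous_on_heat_source p \<sigma> w
            continuous_on_subset[OF uC(1)]) auto
      have "v t = ?e (heat t u0) + ?e (integral {0..t} ?g)"
        using u_eq[OF t] linear_add[OF bounded_linear.linear[OF e]] by (simp add: v_def)
      also have "?e (integral {0..t} ?g) = integral {0..t} (?e \<circ> ?g)"
        by (rule integral_linear[OF int e, symmetric])
      also have "\<dots> = integral {0..t} h"
      proof (rule integral_cong)
        fix s
        assume s: "s \<in> {0..t}"
        have "\<rho> t + (t - s) = \<rho> s"
          by (simp add: \<rho>_def)
        then show "(?e \<circ> ?g) s = h s"
          using s t \<tau> \<rho>[of t] by (simp add: h_def heat_semigroup)
      qed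
      finally show ?thesis
        using t \<tau> by (simp add: \<rho>_def heat_semigroup)
    qed
    have h_ge: "h s \<ge> \<bar>v s\<bar> powr p + s powr \<sigma> * apply_bcontfun (heat (\<rho> s) w) 0" if "s \<in> {0..T}" for s
      using heat_abs_powr_ge[OF p, of "\<rho> s" "u s" 0] \<rho>[of s] that \<tau>
      by (simp add: h_def v_def heat_add heat_scaleR)
    have "v t \<ge> - norm u0 + c * a powr \<sigma> * (t - a) + integral {a..t} (\<lambda>s. \<bar>v s\<bar> powr p)"
      if t: "t \<in> {a..a + 1}" for t
    proof -
      have t': "t \<in> {0..T}"
        using t a by (simp add: T_def)
      have "h integrable_on {0..t}"
        using t' by (intro integrable_continuous_real continuous_on_subset[OF h_cont]) auto
      then have "integral {0..t} h = integral {0..a} h + integral {a..t} h"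
        using t a by (simp add: Henstock_Kurzweil_Integration.integral_combine)
      moreover have "integral {0..a} h \<ge> 0"
      proof (intro Henstock_Kurzweil_Integration.integral_nonneg integrable_continuous_real
            continuous_on_subset[OF h_cont])
        fix s
        assume s: "s \<in> {0..a}"
        then have "0 \<le> \<bar>v s\<bar> powr p + s powr \<sigma> * apply_bcontfun (heat (\<rho> s) w) 0"
          using w_nonneg[OF \<rho>[of s]] by (simp add: T_def)
        also have "\<dots> \<le> h s"
          using h_ge[of s] s by (simp add: T_def)
        finally show "h s \<ge> 0" .
      qed (auto simp: T_def)
      moreover have "integral {a..t} (\<lambda>s. \<bar>v s\<bar> powr p + c * a powr \<sigma>) \<le> integral {a..t} h"
      proof (rule integral_le)
        have "continuous_on {a..t} v"
          using t' a by (intro continuous_on_subset[OF v_cont]) auto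
        then show "(\<lambda>s. \<bar>v s\<bar> powr p + c * a powr \<sigma>) integrable_on {a..t}"
          using p by (intro integrable_continuous_real continuous_on_add continuous_on_powr'
              continuous_intros) auto
        show "h integrable_on {a..t}"
          using t' a by (intro integrable_continuous_real continuous_on_subset[OF h_cont]) auto
        fix s
        assume s: "s \<in> {a..t}"
        have "a powr \<sigma> * c \<le> s powr \<sigma> * apply_bcontfun (heat (\<rho> s) w) 0"
          using s t a c \<sigma> by (intro mult_mono powr_mono2 w_ge) (auto simp: \<rho>_def T_def)
        then show "\<bar>v s\<bar> powr p + c * a powr \<sigma> \<le> h s"
          using h_ge[of s] s t a by (simp add: T_def mult.commute)
      qed
      moreover have "integral {a..t} (\<lambda>s. \<bar>v s\<bar> powr p + c * a powr \<sigma>)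
          = integral {a..t} (\<lambda>s. \<bar>v s\<bar> powr p) + c * a powr \<sigma> * (t - a)"
      proof -
        have "continuous_on {a..t} v"
          using t' a by (intro continuous_on_subset[OF v_cont]) auto
        then have "(\<lambda>s. \<bar>v s\<bar> powr p) integrable_on {a..t}"
          using p by (intro integrable_continuous_real continuous_on_powr' continuous_intros) auto
        from Henstock_Kurzweil_Integration.integral_add[OF this integrable_const_ivl] show ?thesis
          using t by simp
      qed
      moreover have "apply_bcontfun (heat (T + \<tau>) u0) 0 \<ge> - norm u0"
        using norm_bounded[of "heat (T + \<tau>) u0" 0] norm_heat_le[of "T + \<tau>" u0] a \<tau>
        by (simp add: T_def)
      ultimately show ?thesis
        using v_eq[OF t'] by linarith
    qed
    moreover have "continuous_on {a..a + 1} v"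
      using a by (intro continuous_on_subset[OF v_cont]) (auto simp: T_def)
    ultimately show False
      using A0[OF a(2)] by blast
  qed
  then show ?thesis
    using a by (intro that[of T]) (auto simp: T_def)
qed

section \<open>The maximal existence time and blow-up\<close>

definition existence_times ::
  "real \<Rightarrow> real \<Rightarrow> ((real ^ 'n) \<Rightarrow>\<^sub>C real) \<Rightarrow> ((real ^ 'n) \<Rightarrow>\<^sub>C real) \<Rightarrow> real set"
  where "existence_times p \<sigma> w u0 = {t. t > 0 \<and> (\<exists>u. solution_on p \<sigma> w u0 t u)}"

lemma T_max_eq: "T_max p \<sigma> w u0 = Sup (ereal ` existence_times p \<sigma> w u0)"
  by (simp add: T_max_def existence_times_def)

lemma T_max_pos:
  assumes p: "p > 1" and \<sigma>: "\<sigma> > 0" and w: "w \<in> C0" and u0: "u0 \<in> C0"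
  shows "T_max p \<sigma> w u0 > 0"
proof -
  obtain \<delta> where \<delta>: "\<delta> > 0" "\<And>a b \<phi>. \<lbrakk>0 \<le> a; a \<le> b; b \<le> a + \<delta>; b \<le> 1; \<phi> \<in> C0; norm \<phi> \<le> norm u0\<rbrakk> \<Longrightarrow>
      \<exists>v. continuous_on {a..b} v \<and> (\<forall>t\<in>{a..b}. v t \<in> C0 \<and>
        v t = heat (t - a) \<phi> + integral {a..t} (\<lambda>s. heat (t - s) (source p \<sigma> w s (v s))))"
    using local_existence[OF p \<sigma> w, of "norm u0" 1] by auto
  have "min \<delta> 1 \<in> existence_times p \<sigma> w u0"
    using \<delta>(1) \<delta>(2)[of 0 "min \<delta> 1" u0] u0 by (auto simp: existence_times_def solution_on_def)
  then have "ereal (min \<delta> 1) \<le> T_max p \<sigma> w u0"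
    unfolding T_max_eq by (intro Sup_upper imageI)
  moreover have "ereal (min \<delta> 1) > 0"
    using \<delta>(1) by simp
  ultimately show ?thesis
    by order
qed

lemma T_max_finite:
  assumes p: "p > 1" and \<sigma>: "\<sigma> > 0" and w: "w \<in> C0"
    and int: "integrable lborel (apply_bcontfun w)"
    and pos: "(\<integral>x. apply_bcontfun w x \<partial>lborel) > 0"
  shows "T_max p \<sigma> w u0 < \<infinity>"
proof -
  obtain T where T: "T > 0" "\<And>u. \<not> solution_on p \<sigma> w u0 T u"
    using no_global_solution[OF p \<sigma> w int pos] by blast
  have "t < T" if "t \<in> existence_times p \<sigma> w u0" for t
    using that T(2) solution_on_subinterval[of p \<sigma> w u0 t _ T] by (force simp: existence_times_def)
  then have "T_max p \<sigma> w u0 \<le> ereal T"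
    unfolding T_max_eq by (intro Sup_least) (auto intro: less_imp_le)
  then show ?thesis
    by (rule order_le_less_trans) simp
qed

lemma solution_exists_below_T_max:
  assumes "ereal T < T_max p \<sigma> w u0"
  shows "\<exists>u. solution_on p \<sigma> w u0 T u"
proof -
  obtain t where "t \<in> existence_times p \<sigma> w u0" "T < t"
    using assms unfolding T_max_eq less_Sup_iff by auto
  then show ?thesis
    using solution_on_subinterval[of p \<sigma> w u0 t _ T] by (force simp: existence_times_def)
qed

text \<open>By uniqueness, the solutions on the intervals \<open>[0,t]\<close> fit together.\<close>

lemma maximal_solution_exists:
  assumes p: "p > 1" and \<sigma>: "\<sigma> > 0" and w: "w \<in> C0" and u0: "u0 \<in> C0"
  shows "\<exists>u. maximal_solution p \<sigma> w u0 u"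
proof -
  define U where "U t = (SOME v. solution_on p \<sigma> w u0 t v) t" for t
  have "solution_on p \<sigma> w u0 T U" if T: "ereal T < T_max p \<sigma> w u0" for T
  proof -
    obtain v where v: "solution_on p \<sigma> w u0 T v"
      using solution_exists_below_T_max[OF T] by blast
    have "U t = v t" if t: "t \<in> {0..T}" for t
    proof -
      have vt: "solution_on p \<sigma> w u0 t v"
        using v t by (intro solution_on_subinterval[OF v]) auto
      then have "solution_on p \<sigma> w u0 t (SOME v. solution_on p \<sigma> w u0 t v)"
        by (rule someI[where P = "solution_on p \<sigma> w u0 t"])
      from solution_unique[OF p \<sigma> w this vt, of t] show ?thesis
        using t by (simp add: U_def)
    qed
    then show ?thesis
      using v solution_on_cong[of T U v] by simp
  qed
  then have "maximal_solution p \<sigma> w u0 U"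
    using T_max_pos[OF p \<sigma> w u0] by (simp add: maximal_solution_def)
  then show ?thesis
    by blast
qed

text \<open>If the norm were below \<open>Z\<close> at a time \<open>t\<close> close to \<open>Tm\<close>, the solution could be restarted from \<open>u t\<close>.
The length of the new piece depends only on \<open>Z\<close> and \<open>Tm\<close>, so it would reach beyond \<open>Tm\<close>.\<close>

lemma norm_maximal_solution_at_top:
  assumes p: "p > 1" and \<sigma>: "\<sigma> > 0" and w: "w \<in> C0"
    and u: "maximal_solution p \<sigma> w u0 u" and Tm: "T_max p \<sigma> w u0 = ereal Tm"
  shows "filterlim (\<lambda>t. norm (u t)) at_top (at_left Tm)"
  unfolding filterlim_at_top
proof
  fix Z
  have Tm_pos: "Tm > 0"
    using u by (simp add: maximal_solution_def Tm)
  have sol: "solution_on p \<sigma> w u0 t u" if "0 < t" "t < Tm" for t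
    using that u by (simp add: maximal_solution_def Tm)
  obtain \<delta> where \<delta>: "\<delta> > 0" "\<And>a b \<phi>. \<lbrakk>0 \<le> a; a \<le> b; b \<le> a + \<delta>; b \<le> Tm + 1; \<phi> \<in> C0; norm \<phi> \<le> max Z 0\<rbrakk> \<Longrightarrow>
      \<exists>v. continuous_on {a..b} v \<and> (\<forall>t\<in>{a..b}. v t \<in> C0 \<and>
        v t = heat (t - a) \<phi> + integral {a..t} (\<lambda>s. heat (t - s) (source p \<sigma> w s (v s))))"
    using local_existence[OF p \<sigma> w, of "max Z 0" "Tm + 1"] Tm_pos by auto
  define \<eta> where "\<eta> = min \<delta> 1"
  have \<eta>: "\<eta> > 0" "\<eta> \<le> \<delta>" "\<eta> \<le> 1"
    using \<delta>(1) by (auto simp: \<eta>_def)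
  have "Z \<le> norm (u t)" if t: "max 0 (Tm - \<eta>) < t" "t < Tm" for t
  proof (rule ccontr)
    assume "\<not> Z \<le> norm (u t)"
    have t0: "0 < t"
      using t by simp
    have "u t \<in> C0"
      using sol[OF t0 t(2)] t0 by (auto simp: solution_on_def)
    moreover have "norm (u t) \<le> max Z 0"
      using \<open>\<not> Z \<le> norm (u t)\<close> by simp
    ultimately obtain v where v: "continuous_on {t..t + \<eta>} v"
      "\<forall>s\<in>{t..t + \<eta>}. v s \<in> C0 \<and>
        v s = heat (s - t) (u t) + integral {t..s} (\<lambda>r. heat (s - r) (source p \<sigma> w r (v r)))"
      using \<delta>(2)[of t "t + \<eta>" "u t"] \<eta> t t0 by fastforce
    have "solution_on p \<sigma> w u0 (t + \<eta>) (\<lambda>s. if s \<le> t then u s else v s)"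
    proof (rule solution_extend[OF p \<sigma> w _ _ sol[OF t0 t(2)] v(1)])
      fix s
      assume "s \<in> {t..t + \<eta>}"
      with v(2) show "v s \<in> C0"
        "v s = heat (s - t) (u t) + integral {t..s} (\<lambda>r. heat (s - r) (source p \<sigma> w r (v r)))"
        by blast+
    qed (use t0 \<eta> in auto)
    then have "t + \<eta> \<in> existence_times p \<sigma> w u0"
      using t0 \<eta> by (auto simp: existence_times_def)
    then have "ereal (t + \<eta>) \<le> ereal Tm"
      unfolding Tm[symmetric] T_max_eq by (intro Sup_upper imageI)
    then show False
      using t by simp
  qed
  moreover have "max 0 (Tm - \<eta>) < Tm"
    using \<eta> Tm_pos by simp
  ultimately show "\<forall>\<^sub>F t in at_left Tm. Z \<le> norm (u t)"
    unfolding eventually_at_left_field by blast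
qed

theorem theorem1p2:
  fixes p \<sigma> \<alpha> :: real and w u0 :: "(real ^ 'n) \<Rightarrow>\<^sub>C real"
  assumes "CARD('n) \<ge> 2"
    and "p > 1"
    and "\<sigma> > 0"
    and "0 < \<alpha>" and "\<alpha> < 1"
    and "w \<in> C0_holder \<alpha>"
    and "integrable lborel (apply_bcontfun w)"
    and "(\<integral>x. apply_bcontfun w x \<partial>lborel) > 0"
    and "u0 \<in> C0"
  shows "(\<exists>u. maximal_solution p \<sigma> w u0 u) \<and>
    (\<forall>u. maximal_solution p \<sigma> w u0 u \<longrightarrow> blows_up_in_finite_time p \<sigma> w u0 u)"
proof (intro conjI allI impI)
  note p = \<open>p > 1\<close> and \<sigma> = \<open>\<sigma> > 0\<close> and u0 = \<open>u0 \<in> C0\<close>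
  have w: "w \<in> C0"
    using \<open>w \<in> C0_holder \<alpha>\<close> by (simp add: C0_holder_def)
  show "\<exists>u. maximal_solution p \<sigma> w u0 u"
    by (rule maximal_solution_exists[OF p \<sigma> w u0])
  fix u
  assume u: "maximal_solution p \<sigma> w u0 u"
  have "T_max p \<sigma> w u0 < \<infinity>"
    by (rule T_max_finite[OF p \<sigma> w assms(7,8)])
  moreover from this obtain Tm where Tm: "T_max p \<sigma> w u0 = ereal Tm"
    using T_max_pos[OF p \<sigma> w u0] by (cases "T_max p \<sigma> w u0") auto
  ultimately show "blows_up_in_finite_time p \<sigma> w u0 u"
    using norm_maximal_solution_at_top[OF p \<sigma> w u Tm] by (simp add: blows_up_in_finite_time_def)
qed

end
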